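(* Let $G$ be a connected series-parallel graph. Then there exists $\varepsilon > 0$ such that $\mathrm{ex}(Q_n, X(G)) = O(n^{-\varepsilon} 2^n)$ as $n \to \infty$.
   Context: Graphs here may be multigraphs (loops and parallel edges allowed). A series-parallel graph is a multigraph with no $K_4$ minor. A spanning tree of a multigraph is a set of edges forming a tree containing every vertex. $Q_n$ is the $n$-dimensional hypercube with vertex set $\{0,1\}^n$. For $d \le n$, an embedding $Q_d \to Q_n$ is a graph isomorphism of $Q_d$ onto a $d$-dimensional face (subcube) of $Q_n$. For $X \subseteq V(Q_d)$, $\mathrm{ex}(Q_n, X)$ is the maximum size of a set $S \subseteq V(Q_n)$ such that $\psi(X) \not\subseteq S$ for every embedding $\psi: Q_d \to Q_n$. For a connected multigraph $G$ with a fixed ordering of $E(G)$, $X(G) \subseteq \{0,1\}^{E(G)} = V(Q_{e(G)})$ is the set of indicator strings of edge sets of spanning trees of $G$ (here $e(G) = |E(G)|$). *)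

theory Defs
  imports "HOL-Library.Landau_Symbols"
begin

section \<open>Multigraphs\<close>

text \<open>Undirected multigraphs: edges are abstract objects, so parallel edges are distinct edges
  with the same set of ends; a loop is an edge whose set of ends is a singleton.\<close>

record ('v, 'e) mgraph =
  verts :: "'v set"
  edges :: "'e set"
  ends :: "'e \<Rightarrow> 'v set"

locale multigraph =
  fixes G :: "('v, 'e) mgraph"
  assumes finite_verts: "finite (verts G)"
    and finite_edges: "finite (edges G)"
    and ends_subset: "e \<in> edges G \<Longrightarrow> ends G e \<subseteq> verts G"
    and card_ends: "e \<in> edges G \<Longrightarrow> card (ends G e) = 1 \<or> card (ends G e) = 2"

definition adj_rel :: "('v, 'e) mgraph \<Rightarrow> ('v \<times> 'v) set" where
  "adj_rel G = {(u, v). \<exists>e\<in>edges G. ends G e = {u, v}}"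

definition connected_mgraph :: "('v, 'e) mgraph \<Rightarrow> bool" where
  "connected_mgraph G \<longleftrightarrow>
     verts G \<noteq> {} \<and> (\<forall>u\<in>verts G. \<forall>v\<in>verts G. (u, v) \<in> (adj_rel G)\<^sup>*)"

text \<open>A cycle visits the distinct vertices of \<open>vs\<close> in cyclic order along the distinct edges
  of \<open>ces\<close>. A loop is a cycle of length 1, two parallel edges form a cycle of length 2.\<close>

definition is_cycle :: "('v, 'e) mgraph \<Rightarrow> 'v list \<Rightarrow> 'e list \<Rightarrow> bool" where
  "is_cycle G vs ces \<longleftrightarrow>
     vs \<noteq> [] \<and> length ces = length vs \<and> distinct vs \<and> distinct ces \<and>
     set vs \<subseteq> verts G \<and> set ces \<subseteq> edges G \<and>
     (\<forall>i<length vs. ends G (ces ! i) = {vs ! i, vs ! (Suc i mod length vs)})"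

definition is_tree :: "('v, 'e) mgraph \<Rightarrow> bool" where
  "is_tree G \<longleftrightarrow> connected_mgraph G \<and> (\<nexists>vs ces. is_cycle G vs ces)"

definition spanning_tree :: "('v, 'e) mgraph \<Rightarrow> 'e set \<Rightarrow> bool" where
  "spanning_tree G T \<longleftrightarrow> T \<subseteq> edges G \<and> is_tree (G\<lparr>edges := T\<rparr>)"


section \<open>Minors and series-parallel graphs\<close>

definition delete_edge :: "('v, 'e) mgraph \<Rightarrow> 'e \<Rightarrow> ('v, 'e) mgraph" where
  "delete_edge G e = G\<lparr>edges := edges G - {e}\<rparr>"

definition delete_vertex :: "('v, 'e) mgraph \<Rightarrow> 'v \<Rightarrow> ('v, 'e) mgraph" where
  "delete_vertex G v =
     G\<lparr>verts := verts G - {v}, edges := {e \<in> edges G. v \<notin> ends G e}\<rparr>"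

text \<open>Contraction of an edge \<open>e\<close> with ends \<open>u\<close>, \<open>v\<close>: remove \<open>e\<close> and identify \<open>v\<close> with \<open>u\<close>.
  Other edges between \<open>u\<close> and \<open>v\<close> become loops, and parallel edges are kept. If \<open>e\<close> is a loop
  (\<open>u = v\<close>), contracting it is the same as deleting it.\<close>

definition contract_edge :: "('v, 'e) mgraph \<Rightarrow> 'e \<Rightarrow> 'v \<Rightarrow> 'v \<Rightarrow> ('v, 'e) mgraph" where
  "contract_edge G e u v =
     (let \<pi> = (\<lambda>x. if x = v then u else x)
      in \<lparr>verts = \<pi> ` verts G, edges = edges G - {e}, ends = (\<lambda>f. \<pi> ` ends G f)\<rparr>)"

text \<open>\<open>reduces_to G H\<close>: \<open>H\<close> arises from \<open>G\<close> by finitely many deletions and contractions.\<close>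

inductive reduces_to :: "('v, 'e) mgraph \<Rightarrow> ('v, 'e) mgraph \<Rightarrow> bool" for G where
  refl: "reduces_to G G"
| delete_edge: "reduces_to G H \<Longrightarrow> e \<in> edges H \<Longrightarrow> reduces_to G (delete_edge H e)"
| delete_vertex: "reduces_to G H \<Longrightarrow> v \<in> verts H \<Longrightarrow> reduces_to G (delete_vertex H v)"
| contract_edge: "reduces_to G H \<Longrightarrow> e \<in> edges H \<Longrightarrow> ends H e = {u, v} \<Longrightarrow>
    reduces_to G (contract_edge H e u v)"

definition mgraph_iso :: "('v, 'e) mgraph \<Rightarrow> ('w, 'f) mgraph \<Rightarrow> bool" where
  "mgraph_iso G H \<longleftrightarrow>
     (\<exists>f g. bij_betw f (verts G) (verts H) \<and> bij_betw g (edges G) (edges H) \<and>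
       (\<forall>e\<in>edges G. ends H (g e) = f ` ends G e))"

definition has_minor :: "('v, 'e) mgraph \<Rightarrow> ('w, 'f) mgraph \<Rightarrow> bool" where
  "has_minor G K \<longleftrightarrow> (\<exists>H. reduces_to G H \<and> mgraph_iso K H)"

definition complete_mgraph :: "nat \<Rightarrow> (nat, nat set) mgraph" where
  "complete_mgraph k =
     \<lparr>verts = {..<k}, edges = {A. A \<subseteq> {..<k} \<and> card A = 2}, ends = (\<lambda>A. A)\<rparr>"

definition series_parallel :: "('v, 'e) mgraph \<Rightarrow> bool" where
  "series_parallel G \<longleftrightarrow> \<not> has_minor G (complete_mgraph 4)"


section \<open>Hypercubes\<close>

definition cube :: "nat \<Rightarrow> bool list set" where
  "cube n = {x. length x = n}"

definition cube_adj :: "bool list \<Rightarrow> bool list \<Rightarrow> bool" where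
  "cube_adj x y \<longleftrightarrow> length x = length y \<and> card {i. i < length x \<and> x ! i \<noteq> y ! i} = 1"

text \<open>A \<open>d\<close>-dimensional face: the coordinates in a \<open>d\<close>-element set \<open>D\<close> are free, all others
  are fixed to those of \<open>a\<close>.\<close>

definition is_face :: "nat \<Rightarrow> nat \<Rightarrow> bool list set \<Rightarrow> bool" where
  "is_face d n F \<longleftrightarrow>
     (\<exists>D a. D \<subseteq> {..<n} \<and> card D = d \<and> a \<in> cube n \<and>
       F = {x \<in> cube n. \<forall>i\<in>{..<n} - D. x ! i = a ! i})"

definition cube_embedding :: "nat \<Rightarrow> nat \<Rightarrow> (bool list \<Rightarrow> bool list) \<Rightarrow> bool" where
  "cube_embedding d n \<psi> \<longleftrightarrow>
     (\<exists>F. is_face d n F \<and> bij_betw \<psi> (cube d) F \<and>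
       (\<forall>x\<in>cube d. \<forall>y\<in>cube d. cube_adj x y \<longleftrightarrow> cube_adj (\<psi> x) (\<psi> y)))"

text \<open>For \<open>X \<subseteq> cube d\<close>, \<open>cube_ex d n X\<close> is the number ex(Q(n), X). The maximum is over a nonempty
  set whenever \<open>X\<close> is nonempty; for \<open>X = {}\<close> and \<open>d \<le> n\<close> no admissible \<open>S\<close> exists.\<close>

definition cube_ex :: "nat \<Rightarrow> nat \<Rightarrow> bool list set \<Rightarrow> nat" where
  "cube_ex d n X =
     Max {card S | S. S \<subseteq> cube n \<and> (\<forall>\<psi>. cube_embedding d n \<psi> \<longrightarrow> \<not> \<psi> ` X \<subseteq> S)}"

text \<open>The indicator strings of the spanning trees, where the list \<open>es\<close> is the chosen ordering
  of the edges.\<close>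

definition tree_strings :: "('v, 'e) mgraph \<Rightarrow> 'e list \<Rightarrow> bool list set" where
  "tree_strings G es = {map (\<lambda>e. e \<in> T) es | T. spanning_tree G T}"

end

theory Submission
  imports Defs "HOL-Library.FuncSet" "HOL-Library.Transitive_Closure_Table"
begin

text \<open>A series-parallel graph is built from a single vertex by adding loops and pendant edges, doubling
  edges and subdividing edges (by Dirac's theorem, a simple graph without \<open>K\<^sub>4\<close> minor has a vertex of
  degree at most 2). It therefore suffices to see that a polynomial bound for a configuration \<open>X\<close>
  survives these operations, the crucial one being a parallel extension \<open>X'\<close>. If \<open>S\<close> contains no copy
  of \<open>X'\<close>, then a copy of \<open>X\<close> in \<open>S\<close> is determined by its restriction to all but one coordinate, so \<open>S\<close>
  contains at most \<open>n ^ (d - 1) * 2 ^ n\<close> copies of \<open>X\<close>, and hence very few inside a typical subcube of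
  dimension \<open>m\<close>, a small power of \<open>n\<close>. Deleting one point from each of them leaves a set that has no copy
  of \<open>X\<close> in that subcube. Subdivision is dual to doubling: it differs by flips of coordinates.\<close>

section \<open>Polynomially sparse configurations\<close>

text \<open>With \<open>d\<close> coordinates in the small cube, a cube of dimension
  \<open>n\<close> has up to \<open>n ^ d * 2 ^ n\<close> pairs \<open>(f, B)\<close>, and a random
  \<open>m\<close>-subset of the coordinates contains the \<open>d\<close> directions of a given
  copy with probability at most \<open>(d * m / n) ^ d\<close>. Without the one factor
  \<open>n\<close> saved by the parallel extension, deleting a point from each copy inside could
  cost more than all of \<open>2 ^ n\<close>. With it the cost is
  \<open>(d * m) ^ d / n * 2 ^ n\<close>, so \<open>m\<close> has to stay below
  \<open>n powr (1 / d)\<close> and yet be a power of \<open>n\<close>, in order that the bound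
  inside the subcube remains polynomial in \<open>n\<close>. Each such extension may divide the
  exponent by \<open>2 * d\<close>, which is why \<epsilon> depends on the graph. On the graph side
  it suffices to include the spanning trees of \<open>G\<close> in the extension of those of a
  smaller graph, since a subset of a sparse configuration is sparse. Multigraphs are forced by the
  induction: contracting an edge at a vertex of degree 2 may create parallel edges.\<close>

definition cube_map :: "('e \<Rightarrow> 'a) \<Rightarrow> 'a set \<Rightarrow> 'e set \<Rightarrow> 'a set" where
  "cube_map f B T = sym_diff (f ` T) B"

text \<open>Up to the choice of the coordinates, every isomorphism of a cube onto a face of a larger cube
  is of the form \<open>T \<mapsto> f ` T \<triangle> B\<close>; elements of \<open>B\<close> inside the range of \<open>f\<close> are coordinate flips,
  those outside fix the face.\<close>

definition copies :: "'e set \<Rightarrow> 'e set set \<Rightarrow> 'a set \<Rightarrow> 'a set set \<Rightarrow> (('e \<Rightarrow> 'a) \<times> 'a set) set" where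
  "copies E X V S =
     {(f, B). f \<in> E \<rightarrow>\<^sub>E V \<and> inj_on f E \<and> B \<subseteq> V \<and> (\<forall>T\<in>X. cube_map f B T \<in> S)}"

lemma cube_map_cong: "(\<And>e. e \<in> T \<Longrightarrow> f e = g e) \<Longrightarrow> cube_map f B T = cube_map g B T"
  unfolding cube_map_def by (metis image_cong)

lemma copies_nonemptyI:
  assumes "X \<subseteq> Pow E" "f ` E \<subseteq> V" "inj_on f E" "B \<subseteq> V" "\<And>T. T \<in> X \<Longrightarrow> cube_map f B T \<in> S"
  shows "copies E X V S \<noteq> {}"
proof -
  have "cube_map (restrict f E) B T = cube_map f B T" if "T \<in> X" for T
    using that assms(1) by (intro cube_map_cong) auto
  then have "(restrict f E, B) \<in> copies E X V S"
    using assms by (auto simp: copies_def)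
  then show ?thesis by blast
qed

lemma copies_nonemptyE:
  assumes "copies E X V S \<noteq> {}"
  obtains f B where "f \<in> E \<rightarrow>\<^sub>E V" "f ` E \<subseteq> V" "inj_on f E" "B \<subseteq> V" "\<forall>T\<in>X. cube_map f B T \<in> S"
proof -
  from assms obtain f B where "(f, B) \<in> copies E X V S" by auto
  then show ?thesis by (intro that[of f B]) (auto simp: copies_def)
qed

lemma copies_antimono:
  assumes "X \<subseteq> Y" shows "copies E Y V S \<subseteq> copies E X V S"
  using assms by (auto simp: copies_def)

lemma finite_copies:
  assumes "finite E" "finite V"
  shows "finite (copies E X V S)"
proof (rule finite_subset)
  show "copies E X V S \<subseteq> (E \<rightarrow>\<^sub>E V) \<times> Pow V"
    by (auto simp: copies_def)
qed (use assms in \<open>simp add: finite_PiE\<close>)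

text \<open>Arbitrary finite ground sets, rather than initial segments, let the bound be applied to
  a subcube on \<open>M \<subseteq> V\<close> without renumbering. The case \<open>V = {}\<close>
  must be excluded because \<open>0 powr a = 0\<close>, while \<open>S\<close> may still contain the
  empty set.\<close>

definition poly_sparse :: "'e set \<Rightarrow> 'e set set \<Rightarrow> bool" where
  "poly_sparse E X \<longleftrightarrow>
     (\<exists>\<epsilon>>0. \<exists>C\<ge>0. \<forall>(V::nat set) S. finite V \<and> V \<noteq> {} \<and> S \<subseteq> Pow V \<and> copies E X V S = {} \<longrightarrow>
        real (card S) \<le> C * real (card V) powr (- \<epsilon>) * 2 ^ card V)"

text \<open>Ground sets with fewer than \<open>N\<close> elements are covered by the trivial bound
  \<open>2 ^ card V\<close> once the constant is at least \<open>N powr \<epsilon>\<close>; the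
  absolute value makes the constant nonnegative.\<close>

lemma poly_sparse_eventuallyI:
  assumes "\<epsilon> > 0"
    and *: "\<And>(V::nat set) S. finite V \<Longrightarrow> card V \<ge> N \<Longrightarrow> V \<noteq> {} \<Longrightarrow> S \<subseteq> Pow V \<Longrightarrow> copies E X V S = {} \<Longrightarrow>
          real (card S) \<le> C * real (card V) powr (- \<epsilon>) * 2 ^ card V"
  shows "poly_sparse E X"
proof -
  define C' where "C' = max \<bar>C\<bar> (real N powr \<epsilon>)"
  have "real (card S) \<le> C' * real (card V) powr (- \<epsilon>) * 2 ^ card V"
    if V: "finite V" "V \<noteq> {}" "S \<subseteq> Pow V" "copies E X V S = {}" for V :: "nat set" and S
  proof (cases "card V \<ge> N")
    case True
    have "real (card S) \<le> C * real (card V) powr (- \<epsilon>) * 2 ^ card V"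
      using * V True by blast
    also have "\<dots> \<le> C' * real (card V) powr (- \<epsilon>) * 2 ^ card V"
      by (intro mult_right_mono) (auto simp: C'_def)
    finally show ?thesis .
  next
    case False
    have n: "card V > 0" using V by (simp add: card_gt_0_iff)
    have "card S \<le> 2 ^ card V"
      using V card_mono[of "Pow V" S] by (simp add: card_Pow)
    then have "real (card S) \<le> 2 ^ card V"
      by (metis of_nat_le_iff of_nat_numeral of_nat_power)
    also have "\<dots> = real (card V) powr \<epsilon> * real (card V) powr (- \<epsilon>) * 2 ^ card V"
      using n by (simp add: powr_add[symmetric])
    also have "\<dots> \<le> C' * real (card V) powr (- \<epsilon>) * 2 ^ card V"
    proof (intro mult_right_mono)
      have "real (card V) powr \<epsilon> \<le> real N powr \<epsilon>"
        using False \<open>\<epsilon> > 0\<close> by (intro powr_mono2) auto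
      then show "real (card V) powr \<epsilon> \<le> C'" by (simp add: C'_def)
    qed auto
    finally show ?thesis .
  qed
  moreover have "C' \<ge> 0" by (simp add: C'_def)
  ultimately show ?thesis
    unfolding poly_sparse_def using \<open>\<epsilon> > 0\<close>
    by (intro exI[of _ \<epsilon>] exI[of _ C'] conjI allI impI) simp_all
qed

text \<open>A set free of \<open>X'\<close> is then free of \<open>X\<close>, so the exponent
  carries over unchanged. The threshold \<open>N\<close> leaves room for operations that need spare
  coordinates in \<open>V\<close>.\<close>

lemma poly_sparse_if_copies:
  assumes sp: "poly_sparse E X"
    and *: "\<And>(V::nat set) S. finite V \<Longrightarrow> card V \<ge> N \<Longrightarrow> S \<subseteq> Pow V \<Longrightarrow>
          copies E X V S \<noteq> {} \<Longrightarrow> copies E' X' V S \<noteq> {}"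
  shows "poly_sparse E' X'"
proof -
  from sp obtain \<epsilon> C where "\<epsilon> > 0" and
    C: "\<And>(V::nat set) S. finite V \<Longrightarrow> V \<noteq> {} \<Longrightarrow> S \<subseteq> Pow V \<Longrightarrow> copies E X V S = {} \<Longrightarrow>
        real (card S) \<le> C * real (card V) powr (- \<epsilon>) * 2 ^ card V"
    unfolding poly_sparse_def by metis
  show ?thesis
    by (rule poly_sparse_eventuallyI[OF \<open>\<epsilon> > 0\<close>, of N _ _ C]) (use C * in meson)
qed

section \<open>Elementary operations on configurations\<close>

lemma poly_sparse_mono:
  assumes "poly_sparse E Y" "X \<subseteq> Y"
  shows "poly_sparse E X"
  by (rule poly_sparse_if_copies[OF assms(1)]) (use copies_antimono[OF assms(2)] in blast)

text \<open>Flipping the coordinates in \<open>F\<close> before applying \<open>f\<close> is the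
  same as flipping those in the image of \<open>F\<close> afterwards, and the offset
  \<open>B\<close> absorbs this.\<close>

lemma poly_sparse_flip:
  assumes sp: "poly_sparse E X" and X: "X \<subseteq> Pow E" and F: "F \<subseteq> E"
  shows "poly_sparse E ((\<lambda>T. sym_diff T F) ` X)"
proof (rule poly_sparse_if_copies[OF sp])
  fix V :: "nat set" and S
  assume "copies E X V S \<noteq> {}"
  then obtain f B where f0: "f \<in> E \<rightarrow>\<^sub>E V" and f: "f ` E \<subseteq> V" "inj_on f E" "B \<subseteq> V" "\<forall>T\<in>X. cube_map f B T \<in> S"
    by (rule copies_nonemptyE)
  have *: "cube_map f (sym_diff (f ` F) B) (sym_diff T F) = cube_map f B T" if "T \<in> X" for T
  proof -
    have "f ` sym_diff T F = sym_diff (f ` T) (f ` F)"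
      using that X F inj_on_image_set_diff[OF f(2), of T F] inj_on_image_set_diff[OF f(2), of F T]
      by (simp add: image_Un subset_iff)
    then show ?thesis unfolding cube_map_def by auto
  qed
  show "copies E ((\<lambda>T. sym_diff T F) ` X) V S \<noteq> {}"
  proof (rule copies_nonemptyI)
    show "sym_diff (f ` F) B \<subseteq> V" using F f by blast
  qed (use X F f * in auto)
qed

text \<open>Every element of \<open>S\<close> is a copy of a single point, so a free
  \<open>S\<close> is empty. This is the base case of a one-vertex graph without edges.\<close>

lemma poly_sparse_empty: "poly_sparse {} {{}}"
proof (rule poly_sparse_eventuallyI[of 1 0 _ _ 0])
  fix V :: "nat set" and S :: "nat set set"
  assume V: "finite V" "S \<subseteq> Pow V" "copies {} {{}} V S = {}"
  have "S = {}"
  proof (rule ccontr)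
    assume "S \<noteq> {}"
    then obtain B where "B \<in> S" by blast
    with V have "copies {} {{}} V S \<noteq> {}"
      by (intro copies_nonemptyI[where B = B]) (auto simp: cube_map_def)
    with V show False by blast
  qed
  then show "real (card S) \<le> 0 * real (card V) powr - 1 * 2 ^ card V" by simp
qed simp

text \<open>The new coordinate \<open>j\<close> is constantly 0 on \<open>X\<close>, so it may be
  sent to any point outside the range of \<open>f\<close>; there is one as soon as \<open>V\<close>
  has more elements than \<open>E\<close>.\<close>

lemma poly_sparse_insert:
  assumes sp: "poly_sparse E X" and "finite E" and X: "X \<subseteq> Pow E" and j: "j \<notin> E"
  shows "poly_sparse (insert j E) X"
proof (rule poly_sparse_if_copies[OF sp])
  fix V :: "nat set" and S
  assume V: "finite V" "Suc (card E) \<le> card V" and "copies E X V S \<noteq> {}"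
  from this(3) obtain f B where f0: "f \<in> E \<rightarrow>\<^sub>E V" and f: "f ` E \<subseteq> V" "inj_on f E" "B \<subseteq> V" "\<forall>T\<in>X. cube_map f B T \<in> S"
    by (rule copies_nonemptyE)
  have "card (f ` E) < card V"
    using V card_image_le[OF \<open>finite E\<close>, of f] by linarith
  then obtain p where p: "p \<in> V" "p \<notin> f ` E"
    using \<open>finite E\<close> by (metis card_mono finite_imageI linorder_not_less subsetI)
  have im: "(f(j := p)) ` E = f ` E" using j by (auto simp: fun_upd_image)
  show "copies (insert j E) X V S \<noteq> {}"
  proof (rule copies_nonemptyI)
    show "inj_on (f(j := p)) (insert j E)"
      using f(2) p j by (auto simp: inj_on_def)
    show "cube_map (f(j := p)) B T \<in> S" if "T \<in> X" for T
    proof -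
      have "cube_map (f(j := p)) B T = cube_map f B T"
        using that X j by (intro cube_map_cong) auto
      with f(4) that show ?thesis by simp
    qed
  qed (use f X p im in auto)
qed

text \<open>The spanning trees after adding an edge \<open>j\<close> parallel to the edge \<open>i\<close>.\<close>

definition par_ext :: "'e \<Rightarrow> 'e \<Rightarrow> 'e set set \<Rightarrow> 'e set set" where
  "par_ext i j X = X \<union> {insert j (T - {i}) | T. T \<in> X \<and> i \<in> T}"

text \<open>If two values of the coordinate \<open>i\<close> extend the same partial copy, then these two values
  serve as images of \<open>i\<close> and \<open>j\<close> in a copy of \<open>par_ext i j X\<close>.\<close>

lemma card_copies_le:
  fixes V :: "'a set"
  assumes "finite V" "finite E" and X: "X \<subseteq> Pow E" and i: "i \<in> E" and j: "j \<notin> E"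
    and free: "copies (insert j E) (par_ext i j X) V S = {}"
  shows "card (copies E X V S) \<le> card V ^ (card E - 1) * 2 ^ card V"
proof -
  define h :: "('b \<Rightarrow> 'a) \<times> 'a set \<Rightarrow> ('b \<Rightarrow> 'a) \<times> 'a set" where "h = (\<lambda>(f, B). (restrict f (E - {i}), B))"
  have "inj_on h (copies E X V S)"
  proof (intro inj_onI, goal_cases)
    case (1 c c')
    obtain f B where c: "c = (f, B)" by force
    obtain g B' where c': "c' = (g, B')" by force
    from 1 c c' have B': "B' = B" and fg: "restrict f (E - {i}) = restrict g (E - {i})"
      by (auto simp: h_def)
    have eq: "f e = g e" if "e \<in> E" "e \<noteq> i" for e
      using fg that by (metis Diff_iff restrict_apply singletonD)
    have f: "f \<in> E \<rightarrow>\<^sub>E V" "inj_on f E" "B \<subseteq> V" "\<And>T. T \<in> X \<Longrightarrow> cube_map f B T \<in> S"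
      using 1(1) c by (auto simp: copies_def)
    have g: "g \<in> E \<rightarrow>\<^sub>E V" "inj_on g E" "\<And>T. T \<in> X \<Longrightarrow> cube_map g B T \<in> S"
      using 1(2) c' B' by (auto simp: copies_def)
    have "f i = g i"
    proof (rule ccontr)
      assume ne: "f i \<noteq> g i"
      \<comment> \<open>\<open>k\<close> sends \<open>i\<close> to \<open>f i\<close> and
        \<open>j\<close> to \<open>g i\<close>: sets without \<open>j\<close> are then mapped as by
        \<open>f\<close>, and a set in which \<open>j\<close> has replaced \<open>i\<close> is
        mapped as the original set is by \<open>g\<close>.\<close>
      define k where "k = f(j := g i)"
      \<comment> \<open>Needed for injectivity of \<open>k\<close>: away from \<open>i\<close> the
        range of \<open>f\<close> is also that of \<open>g\<close>, and \<open>g\<close> is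
        injective.\<close>
      have gi: "g i \<notin> f ` E"
      proof
        assume "g i \<in> f ` E"
        then obtain e where e: "e \<in> E" "g i = f e" by blast
        with ne have "e \<noteq> i" by auto
        with e eq have "g i = g e" by simp
        with g(2) e i \<open>e \<noteq> i\<close> show False by (metis inj_on_def)
      qed
      have "copies (insert j E) (par_ext i j X) V S \<noteq> {}"
      proof (rule copies_nonemptyI)
        show "par_ext i j X \<subseteq> Pow (insert j E)"
          using X by (auto simp: par_ext_def)
        show "k ` insert j E \<subseteq> V"
          using f(1) g(1) i by (auto simp: k_def)
        have "inj_on k E \<longleftrightarrow> inj_on f E"
          using j by (intro inj_on_cong) (auto simp: k_def)
        moreover have "k ` E = f ` E"
          using j by (intro image_cong) (auto simp: k_def)
        ultimately show "inj_on k (insert j E)"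
          using f(2) gi by (auto simp: k_def)
        show "B \<subseteq> V" by fact
        fix T' assume "T' \<in> par_ext i j X"
        then consider "T' \<in> X" | T where "T \<in> X" "i \<in> T" "T' = insert j (T - {i})"
          by (auto simp: par_ext_def)
        then show "cube_map k B T' \<in> S"
        proof cases
          case 1
          then have "cube_map k B T' = cube_map f B T'"
            using X j by (intro cube_map_cong) (auto simp: k_def)
          with f(4)[OF 1] show ?thesis by simp
        next
          case 2
          have "k ` (T - {i}) = g ` (T - {i})"
            using 2 X j eq by (intro image_cong) (auto simp: k_def)
          moreover have "T = insert i (T - {i})" using 2 by blast
          ultimately have "k ` T' = g ` T"
            using 2 by (metis fun_upd_same image_insert k_def)
          then have "cube_map k B T' = cube_map g B T" by (simp add: cube_map_def)
          with g(3) 2 show ?thesis by simp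
        qed
      qed
      with free show False by simp
    qed
    then have "f = g"
      using eq f(1) g(1) by (metis PiE_ext)
    then show ?case by (simp add: c c' B')
  qed
  moreover have "h ` copies E X V S \<subseteq> ((E - {i}) \<rightarrow>\<^sub>E V) \<times> Pow V"
  proof (rule image_subsetI)
    fix c assume "c \<in> copies E X V S"
    then show "h c \<in> ((E - {i}) \<rightarrow>\<^sub>E V) \<times> Pow V"
      by (cases c) (auto simp: h_def copies_def PiE_def Pi_def)
  qed
  moreover have "finite (((E - {i}) \<rightarrow>\<^sub>E V) \<times> Pow V)"
    using assms by (simp add: finite_PiE)
  ultimately have "card (copies E X V S) \<le> card (((E - {i}) \<rightarrow>\<^sub>E V) \<times> Pow V)"
    by (rule card_inj_on_le)
  also have "\<dots> = card V ^ (card E - 1) * 2 ^ card V"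
    using assms by (simp add: card_cartesian_product card_PiE card_Pow)
  finally show ?thesis .
qed

section \<open>Averaging over subcubes\<close>

lemma card_le_fibres:
  fixes K :: real
  assumes "finite V" and M: "M \<subseteq> V" and X: "X \<subseteq> Pow E" and S: "S \<subseteq> Pow V"
    and free: "\<And>f B. (f, B) \<in> copies E X V S \<Longrightarrow> \<not> f ` E \<subseteq> M"
    and K: "\<And>S'. S' \<subseteq> Pow M \<Longrightarrow> copies E X M S' = {} \<Longrightarrow> real (card S') \<le> K"
  shows "real (card S) \<le> 2 ^ (card V - card M) * K"
proof -
  have fin: "finite (V - M)" "finite S"
    using assms by (auto intro: finite_subset)
  \<comment> \<open>The cube over \<open>V\<close> splits into translates of the cube over
    \<open>M\<close>, one for each trace \<open>A\<close> outside \<open>M\<close>. It is enough to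
    bound \<open>S\<close> on each of them.\<close>
  define F where "F A = {Y \<in> S. Y - M = A}" for A
  have F: "real (card (F A)) \<le> K" if A: "A \<in> Pow (V - M)" for A
  proof -
    define S' where "S' = {Z \<in> Pow M. Z \<union> A \<in> S}"
    have "copies E X M S' = {}"
    proof (rule ccontr)
      assume "copies E X M S' \<noteq> {}"
      then obtain f B where f: "f \<in> E \<rightarrow>\<^sub>E M" "f ` E \<subseteq> M" "inj_on f E" "B \<subseteq> M"
          "\<forall>T\<in>X. cube_map f B T \<in> S'"
        by (rule copies_nonemptyE)
      \<comment> \<open>A copy inside the fibre over \<open>A\<close> becomes a copy in
        \<open>S\<close> when \<open>A\<close> is added to its offset, and its directions still lie
        in \<open>M\<close>; such copies are excluded by \<open>free\<close>.\<close>
      have "cube_map f (B \<union> A) T = cube_map f B T \<union> A" if "T \<in> X" for T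
        using that X f(2,4) A by (auto simp: cube_map_def; blast)
      then have "(f, B \<union> A) \<in> copies E X V S"
        using f M A PiE_mono[of E "\<lambda>_. M" "\<lambda>_. V"] by (auto simp: copies_def S'_def)
      with free f(2) show False by blast
    qed
    then have "real (card S') \<le> K" by (intro K) (auto simp: S'_def)
    moreover have "F A = (\<lambda>Z. Z \<union> A) ` S'"
    proof
      show "F A \<subseteq> (\<lambda>Z. Z \<union> A) ` S'"
      proof
        fix Y assume Y: "Y \<in> F A"
        then have "Y = (Y \<inter> M) \<union> A" by (auto simp: F_def)
        moreover have "Y \<inter> M \<in> S'" using Y calculation by (auto simp: S'_def F_def)
        ultimately show "Y \<in> (\<lambda>Z. Z \<union> A) ` S'" by blast
      qed
      show "(\<lambda>Z. Z \<union> A) ` S' \<subseteq> F A" using A by (auto simp: S'_def F_def)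
    qed
    moreover have "finite S'"
      using M \<open>finite V\<close> by (intro finite_subset[of S' "Pow M"]) (auto simp: S'_def finite_subset)
    ultimately show ?thesis
      by (metis card_image_le of_nat_mono order_trans)
  qed
  have "S = (\<Union>A\<in>Pow (V - M). F A)" using S by (auto simp: F_def)
  then have "card S \<le> (\<Sum>A\<in>Pow (V - M). card (F A))"
    using fin by (metis card_UN_le finite_Pow_iff)
  then have "real (card S) \<le> (\<Sum>A\<in>Pow (V - M). real (card (F A)))"
    by (metis of_nat_le_iff of_nat_sum)
  also have "\<dots> \<le> (\<Sum>A\<in>Pow (V - M). K)" by (rule sum_mono) (rule F)
  also have "\<dots> = 2 ^ (card V - card M) * K"
    using fin M \<open>finite V\<close> by (simp add: card_Pow card_Diff_subset finite_subset)
  finally show ?thesis .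
qed

text \<open>The deletion argument: remove from \<open>S\<close> the image of one fixed
  \<open>T0 \<in> X\<close> under every copy with all its directions in \<open>M\<close>. What
  remains has no such copy, so the bound by fibres applies to it.\<close>

lemma card_le_copies_inside:
  fixes K :: real
  assumes "finite V" "finite E" and M: "M \<subseteq> V" and X: "X \<subseteq> Pow E" "X \<noteq> {}" and S: "S \<subseteq> Pow V"
    and K: "\<And>S'. S' \<subseteq> Pow M \<Longrightarrow> copies E X M S' = {} \<Longrightarrow> real (card S') \<le> K"
  shows "real (card S) \<le> card {c \<in> copies E X V S. fst c ` E \<subseteq> M} + 2 ^ (card V - card M) * K"
proof -
  obtain T0 where T0: "T0 \<in> X" using X by blast
  define C where "C = {c \<in> copies E X V S. fst c ` E \<subseteq> M}"
  define D where "D = (\<lambda>(f, B). cube_map f B T0) ` C"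
  have finC: "finite C" using assms by (simp add: C_def finite_copies)
  then have finD: "finite D" and cardD: "card D \<le> card C"
    by (simp_all add: D_def card_image_le)
  have finS: "finite S" using assms by (auto intro: finite_subset)
  have "real (card (S - D)) \<le> 2 ^ (card V - card M) * K"
  proof (rule card_le_fibres[OF \<open>finite V\<close> M X(1) _ _ K])
    fix f B assume fB: "(f, B) \<in> copies E X V (S - D)"
    then have "cube_map f B T0 \<notin> D" using T0 by (auto simp: copies_def)
    then have "(f, B) \<notin> C" by (force simp: D_def)
    moreover have "(f, B) \<in> copies E X V S" using fB by (auto simp: copies_def)
    ultimately show "\<not> f ` E \<subseteq> M" by (simp add: C_def)
  qed (use S in auto)
  moreover have "card S \<le> card (S - D) + card D"
    using finS finD by (metis card_Un_le card_mono finite_Diff finite_UnI Un_Diff_cancel2 Un_upper1 order_trans)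
  ultimately show ?thesis using cardD unfolding C_def by linarith
qed

text \<open>Sum the previous bound over all \<open>m\<close>-subsets \<open>M\<close> and count
  pairs of a copy and an \<open>M\<close> containing its directions. The directions form a set of
  exactly \<open>card E\<close> elements, so each copy is counted equally often.\<close>

lemma card_mult_choose_le:
  assumes "finite V" "finite E" and X: "X \<subseteq> Pow E" "X \<noteq> {}" and S: "S \<subseteq> Pow V"
    and m: "card E \<le> m" "m \<le> card V"
    and K: "\<And>M S'. M \<subseteq> V \<Longrightarrow> card M = m \<Longrightarrow> S' \<subseteq> Pow M \<Longrightarrow> copies E X M S' = {} \<Longrightarrow> real (card S') \<le> K"
  shows "real (card V choose m) * card S \<le>
    real (card (copies E X V S)) * (card V - card E choose (m - card E)) +
    real (card V choose m) * (2 ^ (card V - m) * K)"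
proof -
  define Ms where "Ms = {M. M \<subseteq> V \<and> card M = m}"
  let ?C = "copies E X V S"
  have finMs: "finite Ms" using \<open>finite V\<close> by (simp add: Ms_def)
  have finC: "finite ?C" using assms by (simp add: finite_copies)
  have cardMs: "card Ms = card V choose m"
    using n_subsets[OF \<open>finite V\<close>] by (simp add: Ms_def)
  have *: "card {M \<in> Ms. fst c ` E \<subseteq> M} = card V - card E choose (m - card E)" if "c \<in> ?C" for c
  proof -
    define D where "D = fst c ` E"
    have D: "D \<subseteq> V" "card D = card E" "finite D"
      using that \<open>finite E\<close> by (auto simp: D_def copies_def card_image)
    have "bij_betw (\<lambda>A. A \<union> D) {A. A \<subseteq> V - D \<and> card A = m - card E} {M \<in> Ms. D \<subseteq> M}"
    proof (rule bij_betwI[where g = "\<lambda>M. M - D"])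
      show "(\<lambda>A. A \<union> D) \<in> {A. A \<subseteq> V - D \<and> card A = m - card E} \<rightarrow> {M \<in> Ms. D \<subseteq> M}"
      proof
        fix A assume "A \<in> {A. A \<subseteq> V - D \<and> card A = m - card E}"
        then have A: "A \<subseteq> V - D" "card A = m - card E" by auto
        then have "card (A \<union> D) = card A + card D"
          using D \<open>finite V\<close> by (intro card_Un_disjoint) (auto intro: finite_subset)
        then show "A \<union> D \<in> {M \<in> Ms. D \<subseteq> M}"
          using A D m by (auto simp: Ms_def)
      qed
      show "(\<lambda>M. M - D) \<in> {M \<in> Ms. D \<subseteq> M} \<rightarrow> {A. A \<subseteq> V - D \<and> card A = m - card E}"
        using D by (auto simp: Ms_def card_Diff_subset)
    qed auto
    then have "card {M \<in> Ms. D \<subseteq> M} = card {A. A \<subseteq> V - D \<and> card A = m - card E}"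
      by (simp add: bij_betw_same_card)
    also have "\<dots> = card (V - D) choose (m - card E)"
      using n_subsets[of "V - D"] \<open>finite V\<close> by simp
    also have "card (V - D) = card V - card E"
      using D by (simp add: card_Diff_subset)
    finally show ?thesis by (simp add: D_def)
  qed
  have "real (card V choose m) * card S = (\<Sum>M\<in>Ms. real (card S))"
    using cardMs by simp
  also have "\<dots> \<le> (\<Sum>M\<in>Ms. real (card {c \<in> ?C. fst c ` E \<subseteq> M}) + 2 ^ (card V - m) * K)"
  proof (rule sum_mono)
    fix M assume "M \<in> Ms"
    then have M: "M \<subseteq> V" "card M = m" by (auto simp: Ms_def)
    show "real (card S) \<le> real (card {c \<in> ?C. fst c ` E \<subseteq> M}) + 2 ^ (card V - m) * K"
      using card_le_copies_inside[OF \<open>finite V\<close> \<open>finite E\<close> M(1) X S K[OF M]] M(2) by simp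
  qed
  also have "\<dots> = real (\<Sum>M\<in>Ms. card {c \<in> ?C. fst c ` E \<subseteq> M}) +
      real (card V choose m) * (2 ^ (card V - m) * K)"
    by (simp add: sum.distrib cardMs)
  also have "(\<Sum>M\<in>Ms. card {c \<in> ?C. fst c ` E \<subseteq> M}) =
      card ?C * (card V - card E choose (m - card E))"
    using sum_multicount_gen[OF finMs finC, of "\<lambda>M c. fst c ` E \<subseteq> M"
        "\<lambda>_. card V - card E choose (m - card E)"] * by simp
  finally show ?thesis by simp
qed

text \<open>The proportion of \<open>m\<close>-subsets containing a fixed \<open>d\<close>-subset is
  \<open>(m choose d) / (n choose d)\<close>, which is at most \<open>m ^ d / (n / d) ^ d\<close>;
  denominators are cleared.\<close>

lemma choose_ratio_le:
  assumes "1 \<le> d" "d \<le> m" "m \<le> n"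
  shows "real (n - d choose (m - d)) * n ^ d \<le> real (n choose m) * (real d ^ d * real m ^ d)"
proof -
  have "(real n / real d) ^ d \<le> real (n choose d)"
    using assms by (intro binomial_ge_n_over_k_pow_k) auto
  then have nd: "real n ^ d \<le> real d ^ d * real (n choose d)"
    using assms by (simp add: power_divide field_simps)
  have md: "real (m choose d) \<le> real m ^ d"
    using binomial_le_pow[of d m] assms by (metis of_nat_le_iff of_nat_power)
  have eq: "(n choose m) * (m choose d) = (n choose d) * (n - d choose (m - d))"
    using assms by (simp add: choose_mult)
  have "real (n - d choose (m - d)) * real n ^ d \<le> real (n - d choose (m - d)) * (real d ^ d * real (n choose d))"
    using nd by (intro mult_left_mono) auto
  also have "\<dots> = real d ^ d * real ((n choose d) * (n - d choose (m - d)))"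
    by (simp add: algebra_simps)
  also have "\<dots> = real d ^ d * (real (n choose m) * real (m choose d))"
    by (simp add: eq[symmetric])
  also have "\<dots> \<le> real d ^ d * (real (n choose m) * real m ^ d)"
    using md by (intro mult_left_mono) auto
  finally show ?thesis by (simp add: algebra_simps)
qed

text \<open>There are at most \<open>n ^ (d - 1) * 2 ^ n\<close> copies, and a proportion of at most
  \<open>(d * m / n) ^ d\<close> of the subcube directions \<open>M\<close> contains a given one.
  The missing factor \<open>n\<close> survives as the division by \<open>card V\<close>.\<close>

lemma card_par_ext_free_le:
  assumes "finite V" "finite E" and X: "X \<subseteq> Pow E" "X \<noteq> {}" and i: "i \<in> E" and j: "j \<notin> E"
    and S: "S \<subseteq> Pow V" and free: "copies (insert j E) (par_ext i j X) V S = {}"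
    and m: "card E \<le> m" "m \<le> card V"
    and K: "\<And>M S'. M \<subseteq> V \<Longrightarrow> card M = m \<Longrightarrow> S' \<subseteq> Pow M \<Longrightarrow> copies E X M S' = {} \<Longrightarrow> real (card S') \<le> \<delta> * 2 ^ m"
  shows "real (card S) \<le> (\<delta> + (real (card E) * real m) ^ card E / card V) * 2 ^ card V"
proof -
  define d n where "d = card E" and "n = card V"
  have d: "1 \<le> d" using i \<open>finite E\<close> by (auto simp: d_def Suc_le_eq card_gt_0_iff)
  have n: "0 < n" "m \<le> n" "d \<le> m" using m d by (auto simp: d_def n_def)
  have chm: "real (n choose m) > 0" using n by simp
  have cop: "card (copies E X V S) \<le> n ^ (d - 1) * 2 ^ n"
    unfolding d_def n_def
    by (rule card_copies_le[OF \<open>finite V\<close> \<open>finite E\<close> X(1) i j free])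
  have "real (card (copies E X V S)) * (n - d choose (m - d)) \<le>
      real (n ^ (d - 1) * 2 ^ n) * (n - d choose (m - d))"
    by (rule mult_right_mono[OF of_nat_mono[OF cop] of_nat_0_le_iff])
  also have "\<dots> = real (n - d choose (m - d)) * n ^ d * (2 ^ n / n)"
  proof -
    have "real n ^ (d - 1) * real n = real n ^ d"
      using d by (intro power_minus_mult) simp
    then show ?thesis using n by (simp add: field_simps)
  qed
  also have "\<dots> \<le> real (n choose m) * (real d ^ d * real m ^ d) * (2 ^ n / n)"
    using choose_ratio_le[OF d] n by (intro mult_right_mono) auto
  finally have 1: "real (card (copies E X V S)) * (n - d choose (m - d)) \<le>
      real (n choose m) * ((real d * real m) ^ d / n * 2 ^ n)"
    by (simp add: power_mult_distrib)
  have "real (n choose m) * card S \<le>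
    real (card (copies E X V S)) * (n - d choose (m - d)) + real (n choose m) * (2 ^ (n - m) * (\<delta> * 2 ^ m))"
    unfolding d_def n_def
    by (rule card_mult_choose_le) (use assms in auto)
  moreover have "2 ^ (n - m) * (\<delta> * 2 ^ m) = \<delta> * 2 ^ n"
    using n by (simp add: power_add[symmetric])
  ultimately have "real (n choose m) * card S \<le>
      real (n choose m) * ((real d * real m) ^ d / n * 2 ^ n) + real (n choose m) * (\<delta> * 2 ^ n)"
    using 1 by simp
  also have "\<dots> = real (n choose m) * ((\<delta> + (real d * real m) ^ d / n) * 2 ^ n)"
    by (simp add: algebra_simps)
  finally have "real (n choose m) * card S \<le> \<dots>" .
  then show ?thesis using chm by (simp add: d_def n_def)
qed

text \<open>Averaging over subcubes of dimension \<open>m = n powr (1 / (2 * d))\<close> balances the two terms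
  of the bound above.\<close>

lemma poly_sparse_par_ext:
  assumes sp: "poly_sparse E X" and "finite E" and X: "X \<subseteq> Pow E" "X \<noteq> {}"
    and i: "i \<in> E" and j: "j \<notin> E"
  shows "poly_sparse (insert j E) (par_ext i j X)"
proof -
  from sp obtain \<epsilon> C where \<epsilon>: "\<epsilon> > 0" and "C \<ge> 0" and
    C: "\<And>(V::nat set) S. finite V \<Longrightarrow> V \<noteq> {} \<Longrightarrow> S \<subseteq> Pow V \<Longrightarrow> copies E X V S = {} \<Longrightarrow>
        real (card S) \<le> C * real (card V) powr (- \<epsilon>) * 2 ^ card V"
    unfolding poly_sparse_def by metis
  define d where "d = card E"
  have d: "1 \<le> d" using i \<open>finite E\<close> by (auto simp: d_def Suc_le_eq card_gt_0_iff)
  \<comment> \<open>The first entry comes from \<open>m powr (- \<epsilon>)\<close> with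
    \<open>m\<close> about \<open>n powr (1 / (2 * d))\<close>, the second from
    \<open>m ^ d / n\<close>, which is about \<open>n powr (- (1 / 2))\<close>.\<close>
  define \<epsilon>' where "\<epsilon>' = min (\<epsilon> / (2 * d)) (1 / 2)"
  show ?thesis
  proof (rule poly_sparse_eventuallyI)
    show "\<epsilon>' > 0" using \<epsilon> d by (simp add: \<epsilon>'_def)
    fix V :: "nat set" and S
    assume V: "finite V" "V \<noteq> {}" "S \<subseteq> Pow V" and nN: "card V \<ge> d ^ (2 * d)"
      and free: "copies (insert j E) (par_ext i j X) V S = {}"
    define n where "n = card V"
    have n: "n \<ge> 1" using V by (auto simp: n_def Suc_le_eq card_gt_0_iff)
    define r where "r = real n powr (1 / (2 * d))"
    define m where "m = nat \<lceil>r\<rceil>"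
    have r1: "r \<ge> 1" using n by (simp add: r_def ge_one_powr_ge_zero)
    \<comment> \<open>Rounding \<open>r\<close> up costs at most a factor 2, because
      \<open>r \<ge> 1\<close>; this is the 2 in the constant \<open>(2 * d) ^ d\<close>.\<close>
    have rm: "r \<le> m" "m \<le> 2 * r" using r1 by (auto simp: m_def) linarith+
    have "r \<le> real n powr 1" unfolding r_def using n d by (intro powr_mono) auto
    then have mn: "m \<le> n" using n by (simp add: m_def)
    \<comment> \<open>The threshold \<open>d ^ (2 * d)\<close> on \<open>card V\<close> is chosen so
      that its \<open>2 * d\<close>-th root is \<open>d\<close>: the subcubes then have dimension at
      least \<open>d\<close>.\<close>
    have "real d = real (d ^ (2 * d)) powr (1 / (2 * d))"
      using d by (simp add: powr_realpow[symmetric] powr_powr)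
    also have "\<dots> \<le> r" unfolding r_def
      using nN by (intro powr_mono2) (auto simp: n_def simp flip: of_nat_power)
    finally have dm: "d \<le> m" using rm by linarith
    define \<delta> where "\<delta> = C * real m powr (- \<epsilon>)"
    have "real (card S) \<le> (\<delta> + (real (card E) * real m) ^ card E / card V) * 2 ^ card V"
    proof (rule card_par_ext_free_le[OF V(1) \<open>finite E\<close> X i j V(3) free])
      show "card E \<le> m" "m \<le> card V" using dm mn by (auto simp: d_def n_def)
      fix M S' assume M: "M \<subseteq> V" "card M = m" "S' \<subseteq> Pow M" "copies E X M S' = {}"
      have "finite M" "M \<noteq> {}"
        using M V dm d by (auto intro: finite_subset)
      then show "real (card S') \<le> \<delta> * 2 ^ m"
        using C[of M S'] M by (simp add: \<delta>_def)
    qed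
    also have "\<dots> \<le> (C + (2 * d) ^ d) * real n powr (- \<epsilon>') * 2 ^ card V"
    proof (rule mult_right_mono)
      have "\<delta> \<le> C * r powr (- \<epsilon>)"
        unfolding \<delta>_def using rm r1 \<epsilon> \<open>C \<ge> 0\<close>
        by (intro mult_left_mono powr_mono2') auto
      also have "r powr (- \<epsilon>) = real n powr (- (\<epsilon> / (2 * d)))"
        by (simp add: r_def powr_powr)
      also have "C * \<dots> \<le> C * real n powr (- \<epsilon>')"
        using n \<open>C \<ge> 0\<close> by (intro mult_left_mono powr_mono) (auto simp: \<epsilon>'_def)
      finally have 1: "\<delta> \<le> C * real n powr (- \<epsilon>')" .
      have "r ^ d = real n powr (1 / 2)"
        using n d by (simp add: r_def powr_realpow[symmetric] powr_powr)
      then have rd: "r ^ d / n = real n powr (- (1 / 2))"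
        using n powr_diff[of "real n" "1 / 2" 1] by simp
      have "(real d * real m) ^ d / n \<le> (real d * (2 * r)) ^ d / n"
        using rm by (intro divide_right_mono power_mono mult_left_mono) auto
      also have "\<dots> = (2 * d) ^ d * (r ^ d / n)"
        by (simp add: power_mult_distrib)
      also have "\<dots> \<le> (2 * d) ^ d * real n powr (- \<epsilon>')"
        unfolding rd using n by (intro mult_left_mono powr_mono) (auto simp: \<epsilon>'_def)
      finally show "\<delta> + (real (card E) * real m) ^ card E / card V \<le>
          (C + (2 * d) ^ d) * real n powr (- \<epsilon>')"
        using 1 by (simp add: d_def n_def algebra_simps)
    qed simp
    finally show "real (card S) \<le> (C + (2 * d) ^ d) * real (card V) powr (- \<epsilon>') * 2 ^ card V"
      by (simp add: n_def)
  qed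
qed

text \<open>The spanning trees after subdividing the edge \<open>i\<close> into \<open>i\<close> and \<open>j\<close>. Up to coordinate flips this
  is a parallel extension, reflecting the duality of the two operations.\<close>

definition ser_ext :: "'e \<Rightarrow> 'e \<Rightarrow> 'e set set \<Rightarrow> 'e set set" where
  "ser_ext i j X = insert j ` X \<union> {insert i T | T. T \<in> X \<and> i \<notin> T}"

text \<open>Flipping \<open>i\<close> turns absence of the edge into presence. Doubling
  \<open>i\<close> now and flipping both \<open>i\<close> and \<open>j\<close> back gives
  \<open>insert j T\<close> for every \<open>T \<in> X\<close>, and \<open>insert i T\<close>
  exactly for those that avoid \<open>i\<close>.\<close>

lemma poly_sparse_ser_ext:
  assumes sp: "poly_sparse E X" and "finite E" and X: "X \<subseteq> Pow E" "X \<noteq> {}"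
    and i: "i \<in> E" and j: "j \<notin> E"
  shows "poly_sparse (insert j E) (ser_ext i j X)"
proof -
  define Y where "Y = (\<lambda>T. sym_diff T {i}) ` X"
  have Y1: "Y \<subseteq> Pow E" unfolding Y_def using X(1) i by blast
  have Y2: "Y \<noteq> {}" unfolding Y_def using X(2) by blast
  have "poly_sparse E Y" unfolding Y_def using i by (intro poly_sparse_flip[OF sp X(1)]) simp
  then have "poly_sparse (insert j E) (par_ext i j Y)"
    by (rule poly_sparse_par_ext[OF _ \<open>finite E\<close> Y1 Y2 i j])
  moreover have "par_ext i j Y \<subseteq> Pow (insert j E)" unfolding par_ext_def using Y1 by blast
  ultimately have "poly_sparse (insert j E) ((\<lambda>T. sym_diff T {i, j}) ` par_ext i j Y)"
    using i by (intro poly_sparse_flip) auto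
  then show ?thesis
  proof (rule poly_sparse_mono)
    have "U \<in> (\<lambda>T. sym_diff T {i, j}) ` par_ext i j Y" if "U \<in> ser_ext i j X" for U
    proof -
      from that consider T where "T \<in> X" "U = insert j T" | T where "T \<in> X" "i \<notin> T" "U = insert i T"
        by (auto simp: ser_ext_def)
      then show ?thesis
      proof cases
        case 1
        then have "sym_diff T {i} \<in> par_ext i j Y" by (auto simp: par_ext_def Y_def)
        moreover have "U = sym_diff (sym_diff T {i}) {i, j}" using 1 X j i by auto
        ultimately show ?thesis by blast
      next
        case 2
        then have "insert i T \<in> Y" unfolding Y_def by (intro image_eqI[of _ _ T]) auto
        then have "insert j (insert i T - {i}) \<in> par_ext i j Y" unfolding par_ext_def by blast
        moreover have "U = sym_diff (insert j (insert i T - {i})) {i, j}" using 2 X j i by auto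
        ultimately show ?thesis by blast
      qed
    qed
    then show "ser_ext i j X \<subseteq> (\<lambda>T. sym_diff T {i, j}) ` par_ext i j Y" by blast
  qed
qed

text \<open>A coordinate that is constantly 1 is a constantly 0 coordinate after a flip.\<close>

lemma poly_sparse_coloop:
  assumes sp: "poly_sparse E X" and "finite E" and X: "X \<subseteq> Pow E" and j: "j \<notin> E"
  shows "poly_sparse (insert j E) (insert j ` X)"
proof -
  have "X \<subseteq> Pow (insert j E)" using X by blast
  then have "poly_sparse (insert j E) ((\<lambda>T. sym_diff T {j}) ` X)"
    by (rule poly_sparse_flip[OF poly_sparse_insert[OF sp \<open>finite E\<close> X j]]) simp
  moreover have "sym_diff T {j} = insert j T" if "T \<in> X" for T
    using that X j by blast
  ultimately show ?thesis by (metis (no_types, lifting) image_cong)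
qed

section \<open>Spanning trees as minimal connected edge sets\<close>

definition conn :: "('v, 'e) mgraph \<Rightarrow> 'e set \<Rightarrow> bool" where
  "conn G T \<longleftrightarrow> connected_mgraph (G\<lparr>edges := T\<rparr>)"

text \<open>Minimality replaces acyclicity because connectivity is easily compared between graphs.
  Testing single edges is enough, since adding edges preserves connectivity.\<close>

definition min_conn :: "('v, 'e) mgraph \<Rightarrow> 'e set set" where
  "min_conn G = {T. T \<subseteq> edges G \<and> conn G T \<and> (\<forall>e\<in>T. \<not> conn G (T - {e}))}"

abbreviation adj_by :: "('v, 'e) mgraph \<Rightarrow> 'e set \<Rightarrow> ('v \<times> 'v) set" where
  "adj_by G T \<equiv> adj_rel (G\<lparr>edges := T\<rparr>)"

lemma adj_by_iff: "(u, v) \<in> adj_by G T \<longleftrightarrow> {u, v} \<in> ends G ` T"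
  by (auto simp: adj_rel_def)

lemma conn_iff:
  "conn G T \<longleftrightarrow> verts G \<noteq> {} \<and> (\<forall>u\<in>verts G. \<forall>v\<in>verts G. (u, v) \<in> (adj_by G T)\<^sup>*)"
  by (simp add: conn_def connected_mgraph_def)

text \<open>Connectivity sees only which pairs of ends occur, not the edges carrying them. This is
  what makes parallel edges interchangeable.\<close>

lemma conn_cong:
  assumes "verts G = verts H" "ends G ` T = ends H ` U"
  shows "conn G T \<longleftrightarrow> conn H U"
proof -
  have "adj_by G T = adj_by H U"
    using assms(2) by (simp add: set_eq_iff adj_by_iff split_paired_all)
  then show ?thesis by (simp add: conn_iff assms(1))
qed

lemma conn_edges: "conn G (edges G) \<longleftrightarrow> connected_mgraph G"
  by (simp add: conn_def)

lemma adj_rtrancl_sym: "(u, v) \<in> (adj_rel G)\<^sup>* \<Longrightarrow> (v, u) \<in> (adj_rel G)\<^sup>*"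
proof -
  have "sym (adj_rel G)" by (auto simp: sym_def adj_rel_def insert_commute)
  then show "(u, v) \<in> (adj_rel G)\<^sup>* \<Longrightarrow> (v, u) \<in> (adj_rel G)\<^sup>*"
    using sym_rtrancl by (metis symD)
qed

text \<open>Every use of \<open>e\<close> in a walk can be replaced by the detour between its
  ends.\<close>

lemma conn_remove:
  assumes "conn G T" and e: "ends G e = {u, v}" and uv: "(u, v) \<in> (adj_by G (T - {e}))\<^sup>*"
  shows "conn G (T - {e})"
proof -
  have "adj_by G T \<subseteq> (adj_by G (T - {e}))\<^sup>*"
  proof (rule subrelI)
    fix a b assume "(a, b) \<in> adj_by G T"
    then obtain f where f: "f \<in> T" "ends G f = {a, b}" by (auto simp: adj_rel_def)
    show "(a, b) \<in> (adj_by G (T - {e}))\<^sup>*"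
    proof (cases "f = e")
      case True
      then have "a = u \<and> b = v \<or> a = v \<and> b = u" using f e by (metis doubleton_eq_iff)
      then show ?thesis using uv adj_rtrancl_sym by metis
    next
      case False
      then show ?thesis using f by (auto simp: adj_rel_def)
    qed
  qed
  then have "(adj_by G T)\<^sup>* \<subseteq> (adj_by G (T - {e}))\<^sup>*"
    by (rule rtrancl_subset_rtrancl)
  then show ?thesis using assms(1) unfolding conn_iff by blast
qed

lemma (in multigraph) edge_endsE:
  assumes "e \<in> edges G"
  obtains u v where "ends G e = {u, v}" "u \<in> verts G" "v \<in> verts G"
proof -
  have "\<exists>u v. ends G e = {u, v}"
    using card_ends[OF assms] by (auto simp: card_1_singleton_iff card_2_iff)
  then show ?thesis using ends_subset[OF assms] that by auto
qed

text \<open>If the ends of \<open>e\<close> were still joined without \<open>e\<close>, a path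
  between them would close up to a cycle through \<open>e\<close>; a loop is a cycle
  already.\<close>

lemma (in multigraph) not_conn_if_acyclic:
  assumes T: "T \<subseteq> edges G" and acyc: "\<nexists>vs ces. is_cycle (G\<lparr>edges := T\<rparr>) vs ces" and e: "e \<in> T"
  shows "\<not> conn G (T - {e})"
proof
  assume con: "conn G (T - {e})"
  obtain u v where uv: "ends G e = {u, v}" "u \<in> verts G" "v \<in> verts G"
    using edge_endsE T e by blast
  show False
  proof (cases "u = v")
    case True
    then have "is_cycle (G\<lparr>edges := T\<rparr>) [u] [e]"
      using uv e by (simp add: is_cycle_def)
    with acyc show False by blast
  next
    case False
    define r where "r = (\<lambda>a b. (a, b) \<in> adj_by G (T - {e}))"
    have "(u, v) \<in> (adj_by G (T - {e}))\<^sup>*" using con uv by (auto simp: conn_iff)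
    then have "r\<^sup>*\<^sup>* u v" by (simp add: r_def rtranclp_rtrancl_eq)
    then obtain ys where "rtrancl_path r u ys v"
      by (auto simp: rtranclp_eq_rtrancl_path)
    then obtain xs where xs: "rtrancl_path r u xs v" and dist: "distinct (u # xs)"
      by (rule rtrancl_path_distinct)
    define vs where "vs = u # xs"
    define k where "k = length xs"
    have k: "k > 0" using xs False by (cases xs) (auto simp: k_def elim: rtrancl_path.cases)
    have step: "r (vs ! i) (vs ! Suc i)" if "i < k" for i
      using rtrancl_path_nth[OF xs, of i] that by (simp add: vs_def k_def)
    have last: "vs ! k = v"
      using rtrancl_path_last[OF xs] k by (simp add: vs_def k_def last_conv_nth nth_Cons')
    have "\<forall>i. \<exists>f. i < k \<longrightarrow> f \<in> T - {e} \<and> ends G f = {vs ! i, vs ! Suc i}"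
      using step by (force simp: r_def adj_rel_def)
    then obtain g where g: "\<And>i. i < k \<Longrightarrow> g i \<in> T - {e}" "\<And>i. i < k \<Longrightarrow> ends G (g i) = {vs ! i, vs ! Suc i}"
      by metis
    have nth_eq: "vs ! i = vs ! j \<longleftrightarrow> i = j" if "i \<le> k" "j \<le> k" for i j
      using dist that by (simp add: vs_def k_def nth_eq_iff_index_eq less_Suc_eq_le)
    \<comment> \<open>Edges chosen for different steps differ: equal end pairs on a path with
      distinct vertices force equal positions, as the crossed case would need
      \<open>i = Suc j\<close> and \<open>Suc i = j\<close>.\<close>
    have inj: "inj_on g {..<k}"
    proof (rule inj_onI)
      fix i j assume ij: "i \<in> {..<k}" "j \<in> {..<k}" "g i = g j"
      then have "{vs ! i, vs ! Suc i} = {vs ! j, vs ! Suc j}" using g(2) by (metis lessThan_iff)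
      then have "i = j \<or> i = Suc j \<and> Suc i = j"
        using ij nth_eq by (auto simp: doubleton_eq_iff Suc_le_eq)
      then show "i = j" by linarith
    qed
    have vs_verts: "set vs \<subseteq> verts G"
    proof -
      have "vs ! i \<in> verts G" if "i \<le> k" for i
      proof (cases "i < k")
        case True
        then show ?thesis using g T ends_subset[of "g i"] by auto
      next
        case False
        then show ?thesis using that last uv by simp
      qed
      moreover have "length vs = Suc k" by (simp add: vs_def k_def)
      ultimately show ?thesis by (metis in_set_conv_nth less_Suc_eq_le subsetI)
    qed
    \<comment> \<open>The edge \<open>e\<close> comes last, since the last pair in cyclic order
      wraps around from \<open>v\<close> to \<open>u\<close>.\<close>
    have "is_cycle (G\<lparr>edges := T\<rparr>) vs (map g [0..<k] @ [e])"
      unfolding is_cycle_def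
    proof (intro conjI allI impI)
      show "distinct (map g [0..<k] @ [e])"
        using inj g(1) by (auto simp: distinct_map atLeast0LessThan)
      show "set (map g [0..<k] @ [e]) \<subseteq> edges (G\<lparr>edges := T\<rparr>)"
        using g(1) e by auto
      fix i assume "i < length vs"
      then have "i \<le> k" by (simp add: vs_def k_def)
      show "ends (G\<lparr>edges := T\<rparr>) ((map g [0..<k] @ [e]) ! i) = {vs ! i, vs ! (Suc i mod length vs)}"
      proof (cases "i < k")
        case True
        then show ?thesis using g(2) by (simp add: nth_append vs_def k_def)
      next
        case False
        then have "i = k" using \<open>i \<le> k\<close> by simp
        then show ?thesis using last uv by (simp add: nth_append k_def insert_commute) (simp add: vs_def insert_commute)
      qed
    qed (use dist vs_verts in \<open>auto simp: vs_def k_def\<close>)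
    with acyc show False by blast
  qed
qed

text \<open>The other edges of a cycle join the ends of its last edge, so that edge could be
  removed. For a loop the joining walk is trivial (\<open>k = 0\<close>).\<close>

lemma acyclic_if_minimal:
  assumes T: "T \<in> min_conn G"
  shows "\<not> is_cycle (G\<lparr>edges := T\<rparr>) vs ces"
proof
  assume c: "is_cycle (G\<lparr>edges := T\<rparr>) vs ces"
  define k where "k = length vs - 1"
  have len: "length vs = Suc k" "length ces = Suc k" using c by (auto simp: is_cycle_def k_def)
  have ends: "ends G (ces ! i) = {vs ! i, vs ! (Suc i mod Suc k)}" if "i \<le> k" for i
    using c that len by (simp add: is_cycle_def)
  have ces: "ces ! i \<in> T" if "i \<le> k" for i
    using c that len by (auto simp: is_cycle_def subset_iff)
  have "(vs ! 0, vs ! i) \<in> (adj_by G (T - {ces ! k}))\<^sup>*" if "i \<le> k" for i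
    using that
  proof (induction i)
    case (Suc i)
    then have "ces ! i \<noteq> ces ! k" using c len by (auto simp: is_cycle_def nth_eq_iff_index_eq)
    then have "(vs ! i, vs ! Suc i) \<in> adj_by G (T - {ces ! k})"
      using Suc.prems ends[of i] ces[of i] by (auto simp: adj_rel_def)
    then show ?case using Suc by (meson Suc_leD rtrancl.rtrancl_into_rtrancl)
  qed simp
  then have "(vs ! 0, vs ! k) \<in> (adj_by G (T - {ces ! k}))\<^sup>*" by simp
  moreover have "ends G (ces ! k) = {vs ! 0, vs ! k}" using ends[of k] by auto
  ultimately have "conn G (T - {ces ! k})"
    using T by (intro conn_remove) (auto simp: min_conn_def)
  then show False using T ces[of k] by (auto simp: min_conn_def)
qed

lemma (in multigraph) spanning_tree_iff: "spanning_tree G T \<longleftrightarrow> T \<in> min_conn G"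
proof
  assume "spanning_tree G T"
  then show "T \<in> min_conn G"
    using not_conn_if_acyclic by (auto simp: spanning_tree_def is_tree_def min_conn_def conn_def)
next
  assume "T \<in> min_conn G"
  then show "spanning_tree G T"
    using acyclic_if_minimal by (auto simp: spanning_tree_def is_tree_def min_conn_def conn_def)
qed

lemma (in multigraph) min_conn_nonempty:
  assumes "connected_mgraph G"
  shows "min_conn G \<noteq> {}"
proof -
  define A where "A = {T \<in> Pow (edges G). conn G T}"
  have "finite A" using finite_edges by (simp add: A_def)
  moreover have "A \<noteq> {}" using assms by (auto simp: A_def conn_edges)
  ultimately obtain T where T: "T \<in> A" "\<And>U. U \<in> A \<Longrightarrow> U \<subseteq> T \<Longrightarrow> T = U"
    using finite_has_minimal[of A] by metis
  have "\<not> conn G (T - {e})" if "e \<in> T" for e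
    using T(2)[of "T - {e}"] T(1) that by (auto simp: A_def)
  then show ?thesis using T(1) by (auto simp: A_def min_conn_def)
qed

lemma min_conn_subset: "min_conn G \<subseteq> Pow (edges G)"
  by (auto simp: min_conn_def)

lemma conn_delete_edge: "conn (delete_edge G e) T \<longleftrightarrow> conn G T"
  by (rule conn_cong) (simp_all add: delete_edge_def)

lemma min_conn_delete_edge: "e \<notin> T \<Longrightarrow> T \<in> min_conn (delete_edge G e) \<longleftrightarrow> T \<in> min_conn G"
  by (auto simp: min_conn_def conn_delete_edge) (auto simp: delete_edge_def)

lemma loop_notin_min_conn:
  assumes "ends G e = {v}" "T \<in> min_conn G"
  shows "e \<notin> T"
  using assms conn_remove[of G T e v v] by (auto simp: min_conn_def)

lemma min_conn_loop:
  assumes "ends G e = {v}"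
  shows "min_conn G \<subseteq> min_conn (delete_edge G e)"
  using loop_notin_min_conn[OF assms] min_conn_delete_edge[of e _ G] by blast

text \<open>A minimal set cannot contain both edges. If it contains \<open>f\<close>, exchanging
  \<open>f\<close> for \<open>e\<close> leaves the end pairs unchanged, also after the removal of
  any one edge, so minimality is inherited.\<close>

lemma min_conn_parallel:
  assumes par: "e \<noteq> f" "e \<in> edges G" "ends G e = {u, v}" "ends G f = {u, v}"
  shows "min_conn G \<subseteq> par_ext e f (min_conn (delete_edge G f))"
proof
  fix T assume T: "T \<in> min_conn G"
  show "T \<in> par_ext e f (min_conn (delete_edge G f))"
  proof (cases "f \<in> T")
    case False
    then show ?thesis using T min_conn_delete_edge[of f T G] by (simp add: par_ext_def)
  next
    case True
    have e: "e \<notin> T"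
    proof
      assume "e \<in> T"
      then have "(u, v) \<in> adj_by G (T - {f})" using par by (auto simp: adj_rel_def)
      then have "conn G (T - {f})"
        using T par(4) by (intro conn_remove) (auto simp: min_conn_def)
      with T True show False by (simp add: min_conn_def)
    qed
    define U where "U = insert e (T - {f})"
    have "conn G U \<longleftrightarrow> conn G T"
      using True par by (intro conn_cong) (auto simp: U_def)
    moreover have "conn G (U - {e}) \<longleftrightarrow> conn G (T - {f})"
      using True par e by (intro conn_cong) (auto simp: U_def)
    moreover have "conn G (U - {g}) \<longleftrightarrow> conn G (T - {g})" if "g \<in> T - {f}" for g
    proof (intro conn_cong HOL.refl)
      have "g \<noteq> e" using that e by auto
      then have "U - {g} = insert e (T - {g} - {f})" "T - {g} = insert f (T - {g} - {f})"
        using that True by (auto simp: U_def)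
      then show "ends G ` (U - {g}) = ends G ` (T - {g})"
        using par by (metis image_insert)
    qed
    ultimately have "U \<in> min_conn G"
      using T True par(2) by (auto simp: min_conn_def U_def)
    moreover have "f \<notin> U" using par(1) by (auto simp: U_def)
    ultimately have "U \<in> min_conn (delete_edge G f)" using min_conn_delete_edge[of f U G] by simp
    moreover have "T = insert f (U - {e})" "e \<in> U" using True e by (auto simp: U_def)
    ultimately show ?thesis by (auto simp: par_ext_def)
  qed
qed

section \<open>Contraction and spanning trees\<close>

lemma contract_edge_simps:
  "verts (contract_edge G e u v) = (\<lambda>x. if x = v then u else x) ` verts G"
  "edges (contract_edge G e u v) = edges G - {e}"
  "ends (contract_edge G e u v) f = (\<lambda>x. if x = v then u else x) ` ends G f"
  by (simp_all add: contract_edge_def Let_def)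

lemma verts_contract_edge: "u \<in> verts G \<Longrightarrow> u \<noteq> v \<Longrightarrow> verts (contract_edge G e u v) = verts G - {v}"
  by (auto simp: contract_edge_simps)

text \<open>Walks in \<open>G\<close> project along \<pi>, steps through \<open>e\<close> becoming
  trivial. Conversely, \<open>e \<in> T\<close> joins every \<open>x\<close> to
  \<open>\<pi> x\<close> in \<open>G\<close>, so each edge of the contracted graph is realised by a
  walk in \<open>T\<close>.\<close>

lemma (in multigraph) conn_contract:
  assumes T: "T \<subseteq> edges G" and e: "e \<in> T" "ends G e = {u, v}"
  shows "conn (contract_edge G e u v) (T - {e}) \<longleftrightarrow> conn G T"
proof -
  define \<pi> where "\<pi> = (\<lambda>x. if x = v then u else x)"
  define H where "H = contract_edge G e u v"
  have H: "verts H = \<pi> ` verts G" "\<And>f. ends H f = \<pi> ` ends G f"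
    by (simp_all add: H_def \<pi>_def contract_edge_simps)
  let ?R = "(adj_by G T)\<^sup>*" and ?S = "(adj_by H (T - {e}))\<^sup>*"
  have uv: "(u, v) \<in> adj_by G T" using e by (auto simp: adj_rel_def)
  have pi: "(x, \<pi> x) \<in> ?R" for x
  proof (cases "x = v")
    case True
    then show ?thesis using adj_rtrancl_sym[OF r_into_rtrancl[OF uv]] by (simp add: \<pi>_def)
  qed (simp add: \<pi>_def)
  have GH: "(\<pi> a, \<pi> b) \<in> ?S" if "(a, b) \<in> ?R" for a b
    using that
  proof (induction rule: rtrancl_induct)
    case (step y z)
    from step(2) obtain f where f: "f \<in> T" "ends G f = {y, z}" by (auto simp: adj_rel_def)
    have "(\<pi> y, \<pi> z) \<in> ?S"
    proof (cases "f = e")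
      case True
      then have "\<pi> y = \<pi> z" using f e(2) by (auto simp: \<pi>_def doubleton_eq_iff)
      then show ?thesis by simp
    next
      case False
      then have "(\<pi> y, \<pi> z) \<in> adj_by H (T - {e})" using f H(2)[of f] by (auto simp: adj_rel_def)
      then show ?thesis by (rule r_into_rtrancl)
    qed
    with step(3) show ?case by (rule rtrancl_trans)
  qed simp
  have "adj_by H (T - {e}) \<subseteq> ?R"
  proof (rule subrelI)
    fix a b assume "(a, b) \<in> adj_by H (T - {e})"
    then obtain f where f: "f \<in> T" "\<pi> ` ends G f = {a, b}" using H(2) by (auto simp: adj_rel_def)
    from f(1) T obtain x y where xy: "ends G f = {x, y}" using edge_endsE by blast
    have "(x, y) \<in> ?R" using f xy by (auto simp: adj_rel_def)
    then have "(\<pi> x, \<pi> y) \<in> ?R" using pi adj_rtrancl_sym by (metis rtrancl_trans)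
    moreover have "a = \<pi> x \<and> b = \<pi> y \<or> a = \<pi> y \<and> b = \<pi> x"
      using f(2) xy by (auto simp: doubleton_eq_iff)
    ultimately show "(a, b) \<in> ?R" using adj_rtrancl_sym by metis
  qed
  then have HG: "?S \<subseteq> ?R" by (rule rtrancl_subset_rtrancl)
  have "(\<forall>a\<in>verts H. \<forall>b\<in>verts H. (a, b) \<in> ?S) \<longleftrightarrow> (\<forall>a\<in>verts G. \<forall>b\<in>verts G. (a, b) \<in> ?R)"
  proof (intro iffI ballI)
    fix a b assume *: "\<forall>a\<in>verts H. \<forall>b\<in>verts H. (a, b) \<in> ?S" and "a \<in> verts G" "b \<in> verts G"
    then have "(\<pi> a, \<pi> b) \<in> ?R" using HG H(1) by blast
    then show "(a, b) \<in> ?R" using pi[of a] pi[of b] adj_rtrancl_sym by (metis rtrancl_trans)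
  next
    fix a b assume *: "\<forall>a\<in>verts G. \<forall>b\<in>verts G. (a, b) \<in> ?R" and "a \<in> verts H" "b \<in> verts H"
    then show "(a, b) \<in> ?S" using GH H(1) by auto
  qed
  then show ?thesis unfolding H_def[symmetric] conn_iff using H(1) by simp
qed

lemma (in multigraph) min_conn_contract:
  assumes T: "T \<in> min_conn G" and e: "e \<in> T" "ends G e = {u, v}"
  shows "T - {e} \<in> min_conn (contract_edge G e u v)"
proof -
  have T': "T \<subseteq> edges G" "conn G T" "\<And>f. f \<in> T \<Longrightarrow> \<not> conn G (T - {f})"
    using T by (auto simp: min_conn_def)
  have "conn (contract_edge G e u v) (T - {e})" using conn_contract[OF T'(1) e] T'(2) by simp
  moreover have "\<not> conn (contract_edge G e u v) (T - {e} - {f})" if "f \<in> T - {e}" for f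
  proof -
    have eq: "T - {e} - {f} = T - {f} - {e}" by blast
    show ?thesis unfolding eq
      using conn_contract[of "T - {f}" e u v] T' e that by auto
  qed
  ultimately show ?thesis using T'(1) by (auto simp: min_conn_def contract_edge_simps)
qed

lemma (in multigraph) conn_incident:
  assumes con: "conn G T" and uv: "u \<in> verts G" "v \<in> verts G" "u \<noteq> v"
  obtains f where "f \<in> T" "v \<in> ends G f"
proof -
  have "(v, u) \<in> (adj_by G T)\<^sup>*" using con uv by (simp add: conn_iff)
  then obtain z where "(v, z) \<in> adj_by G T" using uv(3) by (metis converse_rtranclE)
  then show ?thesis using that by (auto simp: adj_rel_def)
qed

text \<open>The edge \<open>e\<close> is the only way to reach \<open>v\<close>, so every spanning
  tree contains it.\<close>

lemma (in multigraph) min_conn_pendant: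
  assumes v: "{f \<in> edges G. v \<in> ends G f} = {e}" and e: "ends G e = {u, v}" "u \<noteq> v"
  shows "min_conn G \<subseteq> insert e ` min_conn (contract_edge G e u v)"
proof
  fix T assume T: "T \<in> min_conn G"
  have uv: "u \<in> verts G" "v \<in> verts G" using v e ends_subset[of e] by auto
  obtain f where "f \<in> T" "v \<in> ends G f"
    using conn_incident[of T u v] T uv e(2) by (auto simp: min_conn_def)
  then have "e \<in> T" using T v by (auto simp: min_conn_def)
  then have "T = insert e (T - {e})" "T - {e} \<in> min_conn (contract_edge G e u v)"
    using min_conn_contract[OF T _ e(1)] by auto
  then show "T \<in> insert e ` min_conn (contract_edge G e u v)" by blast
qed

text \<open>A tree with \<open>e2\<close> is treated by contracting \<open>e2\<close>. A tree
  without \<open>e2\<close> must reach \<open>v\<close> through \<open>e1\<close>, and its other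
  edges avoid \<open>v\<close>.\<close>

lemma (in multigraph) min_conn_series:
  assumes v: "{f \<in> edges G. v \<in> ends G f} = {e1, e2}" "e1 \<noteq> e2"
    and e1: "ends G e1 = {u, v}" "u \<noteq> v" and e2: "ends G e2 = {w, v}" "w \<noteq> v"
  shows "min_conn G \<subseteq> ser_ext e1 e2 (min_conn (contract_edge G e2 w v))"
proof
  fix T assume T: "T \<in> min_conn G"
  show "T \<in> ser_ext e1 e2 (min_conn (contract_edge G e2 w v))"
  proof (cases "e2 \<in> T")
    case True
    then have "T = insert e2 (T - {e2})" "T - {e2} \<in> min_conn (contract_edge G e2 w v)"
      using min_conn_contract[OF T _ e2(1)] by auto
    then show ?thesis unfolding ser_ext_def by blast
  next
    case False
    have uvw: "u \<in> verts G" "v \<in> verts G" "w \<in> verts G"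
      using v e1 e2 ends_subset[of e1] ends_subset[of e2] by auto
    obtain f where "f \<in> T" "v \<in> ends G f"
      using conn_incident[of T u v] T uvw e1(2) by (auto simp: min_conn_def)
    then have "e1 \<in> T" using T v False by (auto simp: min_conn_def)
    define U where "U = T - {e1}"
    have U: "U \<in> min_conn (contract_edge G e1 u v)"
      unfolding U_def using min_conn_contract[OF T \<open>e1 \<in> T\<close> e1(1)] .
    have U_v: "v \<notin> ends G f" if "f \<in> U" for f
      using that False T v by (auto simp: min_conn_def U_def)
    \<comment> \<open>On edges that avoid \<open>v\<close> the two contractions agree: both just
      remove \<open>v\<close> from the vertex set.\<close>
    have "conn (contract_edge G e1 u v) W \<longleftrightarrow> conn (contract_edge G e2 w v) W" if "W \<subseteq> U" for W
    proof (rule conn_cong)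
      show "verts (contract_edge G e1 u v) = verts (contract_edge G e2 w v)"
        using uvw e1 e2 by (simp add: verts_contract_edge)
      have "ends (contract_edge G e1 u v) f = ends (contract_edge G e2 w v) f" if "f \<in> W" for f
        using U_v[of f] that \<open>W \<subseteq> U\<close> by (auto simp: contract_edge_simps image_def)
      then show "ends (contract_edge G e1 u v) ` W = ends (contract_edge G e2 w v) ` W"
        by (rule image_cong[OF HOL.refl])
    qed
    then have "U \<in> min_conn (contract_edge G e2 w v)"
      using U False T by (auto simp: min_conn_def contract_edge_simps U_def)
    moreover have "T = insert e1 U" "e1 \<notin> U" using \<open>e1 \<in> T\<close> by (auto simp: U_def)
    ultimately show ?thesis unfolding ser_ext_def by blast
  qed
qed

section \<open>Dirac's theorem on \<open>K\<^sub>4\<close> minors\<close>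

lemma reduces_to_trans: "reduces_to H K \<Longrightarrow> reduces_to G H \<Longrightarrow> reduces_to G K"
  by (induction rule: reduces_to.induct) (auto intro: reduces_to.intros)

lemma has_minor_reduces_to: "reduces_to G H \<Longrightarrow> has_minor H K \<Longrightarrow> has_minor G K"
  unfolding has_minor_def using reduces_to_trans by blast

lemma reduces_to_edge_subset:
  assumes "finite D"
  shows "reduces_to G (G\<lparr>edges := edges G - D\<rparr>)"
  using assms
proof induction
  case empty
  then show ?case using reduces_to.refl[of G] by simp
next
  case (insert e D)
  let ?H = "G\<lparr>edges := edges G - D\<rparr>"
  show ?case
  proof (cases "e \<in> edges G")
    case True
    then have "reduces_to G (delete_edge ?H e)"
      using insert by (intro reduces_to.delete_edge) auto
    moreover have "delete_edge ?H e = G\<lparr>edges := edges G - insert e D\<rparr>"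
      by (simp add: delete_edge_def Diff_insert2[symmetric]) (metis Diff_insert)
    ultimately show ?thesis by simp
  next
    case False
    then have "edges G - insert e D = edges G - D" by blast
    then show ?thesis using insert by simp
  qed
qed

lemma reduces_to_vertex_subset:
  assumes "finite D" "D \<subseteq> verts G"
  shows "reduces_to G (G\<lparr>verts := verts G - D, edges := {e \<in> edges G. ends G e \<inter> D = {}}\<rparr>)"
  using assms
proof induction
  case empty
  then show ?case using reduces_to.refl[of G] by simp
next
  case (insert v D)
  let ?H = "G\<lparr>verts := verts G - D, edges := {e \<in> edges G. ends G e \<inter> D = {}}\<rparr>"
  have "reduces_to G (delete_vertex ?H v)"
    using insert by (intro reduces_to.delete_vertex) auto
  moreover have "verts G - insert v D = verts G - D - {v}"
    "{e \<in> edges G. ends G e \<inter> insert v D = {}} = {e \<in> edges G. ends G e \<inter> D = {} \<and> v \<notin> ends G e}"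
    by auto
  ultimately show ?case by (simp add: delete_vertex_def)
qed

definition nbrs :: "('v, 'e) mgraph \<Rightarrow> 'v \<Rightarrow> 'v set" where
  "nbrs G v = {u. u \<noteq> v \<and> (\<exists>e\<in>edges G. ends G e = {v, u})}"

lemma nbrsE:
  assumes "u \<in> nbrs G v"
  obtains e where "u \<noteq> v" "e \<in> edges G" "ends G e = {v, u}"
  using assms by (auto simp: nbrs_def)

lemma nbrsI: "u \<noteq> v \<Longrightarrow> e \<in> edges G \<Longrightarrow> ends G e = {v, u} \<Longrightarrow> u \<in> nbrs G v"
  by (auto simp: nbrs_def)

lemma nbrs_sym: "u \<in> nbrs G v \<longleftrightarrow> v \<in> nbrs G u"
  by (auto simp: nbrs_def insert_commute)

lemma nbrs_irrefl: "v \<notin> nbrs G v"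
  by (simp add: nbrs_def)

lemma (in multigraph) nbrs_subset: "nbrs G v \<subseteq> verts G"
  using ends_subset by (fastforce simp: nbrs_def)

lemma (in multigraph) finite_nbrs: "finite (nbrs G v)"
  using nbrs_subset finite_verts by (rule finite_subset)

section \<open>Neighbourhoods under deletion and contraction\<close>

lemma (in multigraph) multigraph_delete_edge: "multigraph (delete_edge G e)"
  using finite_verts finite_edges ends_subset card_ends
  by unfold_locales (auto simp: delete_edge_def)

lemma (in multigraph) multigraph_delete_vertex: "multigraph (delete_vertex G v)"
  using finite_verts finite_edges ends_subset card_ends
  by unfold_locales (auto simp: delete_vertex_def)

lemma (in multigraph) multigraph_contract_edge: "multigraph (contract_edge G e u v)"
proof
  fix f assume "f \<in> edges (contract_edge G e u v)"
  then have f: "f \<in> edges G" by (simp add: contract_edge_simps)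
  then show "ends (contract_edge G e u v) f \<subseteq> verts (contract_edge G e u v)"
    using ends_subset by (auto simp: contract_edge_simps)
  from f obtain x y where "ends G f = {x, y}" using edge_endsE by blast
  then show "card (ends (contract_edge G e u v) f) = 1 \<or> card (ends (contract_edge G e u v) f) = 2"
    unfolding contract_edge_simps by (simp only: image_insert image_empty) (auto simp: card_insert_if)
qed (use finite_verts finite_edges in \<open>simp_all add: contract_edge_simps\<close>)

lemma nbrs_delete_edge:
  assumes "y \<in> nbrs G z" "ends G e \<noteq> {y, z}"
  shows "y \<in> nbrs (delete_edge G e) z"
  using assms by (auto simp: nbrs_def delete_edge_def insert_commute)

lemma nbrs_delete_vertex:
  assumes "y \<in> nbrs G z" "y \<noteq> v" "z \<noteq> v"
  shows "y \<in> nbrs (delete_vertex G v) z"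
  using assms by (auto simp: nbrs_def delete_vertex_def)

lemma nbrs_contract_edge:
  assumes "y \<in> nbrs G z" "y \<noteq> v" "z \<noteq> v" "ends G e = {u, v}"
  shows "y \<in> nbrs (contract_edge G e u v) z"
proof -
  from assms(1) obtain f where f: "y \<noteq> z" "f \<in> edges G" "ends G f = {z, y}" by (rule nbrsE)
  then have "f \<noteq> e" using assms by auto
  then show ?thesis using f assms by (intro nbrsI[of _ _ f]) (auto simp: contract_edge_simps)
qed

lemma nbrs_contract_edge_merged:
  assumes "z \<in> nbrs G v" "z \<noteq> u" "ends G e = {u, v}"
  shows "z \<in> nbrs (contract_edge G e u v) u"
proof -
  from assms(1) obtain f where f: "z \<noteq> v" "f \<in> edges G" "ends G f = {v, z}" by (rule nbrsE)
  then have "f \<noteq> e" using assms by (auto simp: doubleton_eq_iff)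
  then show ?thesis using f assms by (intro nbrsI[of _ _ f]) (auto simp: contract_edge_simps)
qed

text \<open>Delete the vertices outside \<open>A\<close>, then all edges except one chosen for each
  pair in \<open>A\<close>; the isomorphism has to match edges bijectively.\<close>

lemma (in multigraph) has_complete_minor_if_clique:
  assumes A: "A \<subseteq> verts G" "card A = k" "finite A"
    and cl: "\<And>u v. u \<in> A \<Longrightarrow> v \<in> A \<Longrightarrow> u \<noteq> v \<Longrightarrow> v \<in> nbrs G u"
  shows "has_minor G (complete_mgraph k)"
proof -
  let ?P = "{s. s \<subseteq> {..<k} \<and> card s = 2}"
  obtain f where f: "bij_betw f {..<k} A"
    using ex_bij_betw_nat_finite[OF A(3)] A(2) by (auto simp: atLeast0LessThan)
  define g where "g s = (SOME e. e \<in> edges G \<and> ends G e = f ` s)" for s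
  have g: "g s \<in> edges G" "ends G (g s) = f ` s" if "s \<in> ?P" for s
  proof -
    from that obtain i j where s: "s = {i, j}" "i \<noteq> j" by (auto simp: card_2_iff)
    then have "i < k" "j < k" using that by auto
    then have "f i \<in> A" "f j \<in> A" "f i \<noteq> f j"
      using f s(2) by (auto simp: bij_betw_def inj_on_def)
    then have "f j \<in> nbrs G (f i)" using cl by blast
    then have "\<exists>e. e \<in> edges G \<and> ends G e = f ` s" using s by (auto elim!: nbrsE)
    then have "g s \<in> edges G \<and> ends G (g s) = f ` s" unfolding g_def by (rule someI_ex)
    then show "g s \<in> edges G" "ends G (g s) = f ` s" by blast+
  qed
  define D where "D = verts G - A"
  define G1 where "G1 = G\<lparr>verts := verts G - D, edges := {e \<in> edges G. ends G e \<inter> D = {}}\<rparr>"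
  define G2 where "G2 = G1\<lparr>edges := edges G1 - (edges G1 - g ` ?P)\<rparr>"
  have "reduces_to G G1"
    unfolding G1_def using finite_verts by (intro reduces_to_vertex_subset) (auto simp: D_def)
  moreover have "reduces_to G1 G2"
    unfolding G2_def using finite_edges by (intro reduces_to_edge_subset) (auto simp: G1_def)
  ultimately have red: "reduces_to G G2" using reduces_to_trans by blast
  have fA: "f ` s \<subseteq> A" if "s \<in> ?P" for s
    using f that by (auto simp: bij_betw_def)
  have sub: "g ` ?P \<subseteq> edges G1"
  proof
    fix e assume "e \<in> g ` ?P"
    then obtain s where s: "s \<in> ?P" "e = g s" by blast
    then show "e \<in> edges G1" using g fA[OF s(1)] by (auto simp: G1_def D_def)
  qed
  have "inj_on g ?P"
  proof (rule inj_onI)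
    fix s t assume st: "s \<in> ?P" "t \<in> ?P" "g s = g t"
    then have "f ` s = f ` t" using g(2) by metis
    then show "s = t"
      using st(1,2) f inj_on_image_eq_iff[of f "{..<k}" s t] by (auto simp: bij_betw_def)
  qed
  moreover have "edges G2 = g ` ?P" using sub by (auto simp: G2_def)
  ultimately have "bij_betw g ?P (edges G2)" by (simp add: bij_betw_def)
  moreover have "verts G2 = A" using A(1) by (auto simp: G2_def G1_def D_def)
  moreover have "ends G2 (g s) = f ` s" if "s \<in> ?P" for s
    using g(2)[OF that] by (simp add: G2_def G1_def)
  ultimately have "mgraph_iso (complete_mgraph k) G2"
    unfolding mgraph_iso_def complete_mgraph_def using f by (intro exI[of _ f] exI[of _ g]) auto
  with red show ?thesis by (auto simp: has_minor_def)
qed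

lemma card_exchange: "finite A \<Longrightarrow> a \<in> A \<Longrightarrow> b \<notin> A \<Longrightarrow> card (insert b (A - {a})) = card A"
  by (metis Diff_iff card.insert_remove card.remove card_insert_disjoint finite_Diff)

lemma card_nbrs_ge3I:
  assumes "multigraph G" "{a, b, c} \<subseteq> nbrs G v" "a \<noteq> b" "a \<noteq> c" "b \<noteq> c"
  shows "card (nbrs G v) \<ge> 3"
  using card_mono[OF multigraph.finite_nbrs[OF assms(1)] assms(2)] assms(3-) by simp

text \<open>Allowing one exceptional vertex \<open>x\<close> of small degree makes Dirac's theorem amenable to
  induction: contractions into \<open>x\<close> and deletions of edges at \<open>x\<close> only affect few other degrees.\<close>

lemma has_K4_minor_if_degrees_ge_3:
  fixes G :: "('v, 'e) mgraph"
  assumes "multigraph G" "x \<in> verts G" "verts G \<noteq> {x}"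
    and "\<And>v. v \<in> verts G \<Longrightarrow> v \<noteq> x \<Longrightarrow> card (nbrs G v) \<ge> 3"
  shows "has_minor G (complete_mgraph 4)"
  using assms
proof (induction "card (verts G) + card (edges G)" arbitrary: G x rule: less_induct)
  case less
  interpret multigraph G by fact
  note deg = less.prems(4)
  \<comment> \<open>The induction hypothesis for a properly smaller minor \<open>H\<close>:
    \<open>y\<close> is its exceptional vertex, and \<open>z\<close> only witnesses that
    \<open>H\<close> has another one.\<close>
  have step: "has_minor G (complete_mgraph 4)"
    if red: "reduces_to G H" and H: "multigraph H" and v: "verts H \<subseteq> verts G" and e: "edges H \<subseteq> edges G"
      and lt: "verts H \<noteq> verts G \<or> edges H \<noteq> edges G"
      and xy: "y \<in> verts H" "z \<in> verts H" "z \<noteq> y"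
      and d: "\<And>v. v \<in> verts H \<Longrightarrow> v \<noteq> y \<Longrightarrow> card (nbrs H v) \<ge> 3"
    for H :: "('v, 'e) mgraph" and y z
  proof (rule has_minor_reduces_to[OF red])
    have "card (verts H) \<le> card (verts G)" "card (edges H) \<le> card (edges G)"
      using v e finite_verts finite_edges by (auto intro: card_mono)
    moreover have "card (verts H) < card (verts G) \<or> card (edges H) < card (edges G)"
      using v e lt finite_verts finite_edges by (metis psubsetI psubset_card_mono)
    ultimately have "card (verts H) + card (edges H) < card (verts G) + card (edges G)" by linarith
    then show "has_minor H (complete_mgraph 4)"
      using H xy d by (intro less.hyps[of H y]) auto
  qed
  have nbr_verts: "v \<in> verts G" if "v \<in> nbrs G u" for u v using nbrs_subset that by blast
  \<comment> \<open>In the last case every neighbour of \<open>x\<close> has degree exactly 3 and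
    lies in a triangle through \<open>x\<close>; the other cases admit an immediate
    reduction.\<close>
  consider
    (isolated) "nbrs G x = {}"
    | (delete) w where "w \<in> nbrs G x" "card (nbrs G w) \<ge> 4"
    | (contract) w where "w \<in> nbrs G x" "nbrs G w \<inter> nbrs G x = {}"
    | (triangles) w where "w \<in> nbrs G x" "\<And>w. w \<in> nbrs G x \<Longrightarrow> \<not> card (nbrs G w) \<ge> 4"
        "\<And>w. w \<in> nbrs G x \<Longrightarrow> nbrs G w \<inter> nbrs G x \<noteq> {}"
    by blast
  then show ?case
  proof cases
    case isolated
    obtain y where y: "y \<in> verts G" "y \<noteq> x" using less.prems(2,3) by blast
    then have "nbrs G y \<noteq> {}" using deg[OF y] by auto
    then obtain z where z: "z \<in> nbrs G y" by blast
    then have "z \<noteq> y" "z \<noteq> x" "z \<in> verts G"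
      using isolated nbrs_irrefl[of y G] nbrs_sym[of z G y] nbr_verts by auto
    show ?thesis
    proof (rule step[of "delete_vertex G x" y z])
      show "reduces_to G (delete_vertex G x)"
        using less.prems(2) by (intro reduces_to.delete_vertex reduces_to.refl)
      fix v assume v: "v \<in> verts (delete_vertex G x)"
      then have "v \<noteq> x" "v \<in> verts G" by (auto simp: delete_vertex_def)
      have "nbrs G v \<subseteq> nbrs (delete_vertex G x) v"
        using isolated nbrs_sym[of x G v] \<open>v \<noteq> x\<close> by (auto intro!: nbrs_delete_vertex)
      then show "card (nbrs (delete_vertex G x) v) \<ge> 3"
        using deg[OF \<open>v \<in> verts G\<close> \<open>v \<noteq> x\<close>] multigraph.finite_nbrs[OF multigraph_delete_vertex]
        by (meson card_mono order_trans)
    qed (use y \<open>z \<noteq> y\<close> \<open>z \<noteq> x\<close> \<open>z \<in> verts G\<close> less.prems(2) multigraph_delete_vertex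
        in \<open>auto simp: delete_vertex_def\<close>)
  next
    case (delete w)
    then obtain e where e: "w \<noteq> x" "e \<in> edges G" "ends G e = {x, w}" by (auto elim: nbrsE)
    let ?H = "delete_edge G e"
    have fin: "finite (nbrs ?H v)" for v by (rule multigraph.finite_nbrs[OF multigraph_delete_edge])
    show ?thesis
    proof (rule step[of ?H x w])
      show "reduces_to G ?H" using e by (intro reduces_to.delete_edge reduces_to.refl)
      fix v assume "v \<in> verts ?H" and v: "v \<noteq> x"
      then have vG: "v \<in> verts G" by (simp add: delete_edge_def)
      show "card (nbrs ?H v) \<ge> 3"
      proof (cases "v = w")
        case True
        \<comment> \<open>Besides the exceptional \<open>x\<close>, only \<open>w\<close> can lose a
          neighbour, and it had four.\<close>
        have "nbrs G w - {x} \<subseteq> nbrs ?H w"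
          using e by (auto intro!: nbrs_delete_edge simp: doubleton_eq_iff)
        moreover have "card (nbrs G w - {x}) \<ge> 3" using delete(2) card_Diff1_le[of "nbrs G w" x]
          by (auto simp: card_Diff_singleton_if)
        ultimately show ?thesis using True fin by (meson card_mono order_trans)
      next
        case False
        have "nbrs G v \<subseteq> nbrs ?H v"
          using e v False by (auto intro!: nbrs_delete_edge simp: doubleton_eq_iff)
        then show ?thesis using deg[OF vG v] fin by (meson card_mono order_trans)
      qed
    qed (use e less.prems(2) nbr_verts[OF delete(1)] multigraph_delete_edge in \<open>auto simp: delete_edge_def\<close>)
  next
    case (contract w)
    then obtain e where e: "w \<noteq> x" "e \<in> edges G" "ends G e = {x, w}" by (auto elim: nbrsE)
    let ?H = "contract_edge G e x w"
    have fin: "finite (nbrs ?H v)" for v by (rule multigraph.finite_nbrs[OF multigraph_contract_edge])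
    have vH: "verts ?H = verts G - {w}" using e less.prems(2) by (intro verts_contract_edge) auto
    have wG: "w \<in> verts G" using nbr_verts[OF contract(1)] .
    have "nbrs G w - {x} \<noteq> {}"
    proof
      assume "nbrs G w - {x} = {}"
      then have "nbrs G w \<subseteq> {x}" by blast
      then have "card (nbrs G w) \<le> 1" using card_mono[of "{x}" "nbrs G w"] by simp
      with deg[OF wG e(1)] show False by simp
    qed
    then obtain z where z: "z \<in> nbrs G w" "z \<noteq> x" by blast
    then have "z \<noteq> w" "z \<in> verts G" using nbrs_irrefl[of w G] nbr_verts by auto
    show ?thesis
    proof (rule step[of ?H x z])
      show "reduces_to G ?H" using e by (intro reduces_to.contract_edge reduces_to.refl)
      fix v assume "v \<in> verts ?H" and v: "v \<noteq> x"
      then have vG: "v \<in> verts G" "v \<noteq> w" by (auto simp: vH)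
      show "card (nbrs ?H v) \<ge> 3"
      proof (cases "w \<in> nbrs G v")
        case True
        \<comment> \<open>No vertex is adjacent to both \<open>x\<close> and \<open>w\<close>, so
          \<open>v\<close> merely exchanges its neighbour \<open>w\<close> for
          \<open>x\<close>.\<close>
        then have "x \<notin> nbrs G v" using contract(2) nbrs_sym[of v G w] nbrs_sym[of v G x] by blast
        have "insert x (nbrs G v - {w}) \<subseteq> nbrs ?H v"
          using nbrs_contract_edge[of _ G v w e x] nbrs_contract_edge_merged[of v G w x e]
            True e v vG nbrs_sym[of v G w] nbrs_sym[of v ?H x] by auto
        moreover have "card (insert x (nbrs G v - {w})) = card (nbrs G v)"
          using True \<open>x \<notin> nbrs G v\<close> by (intro card_exchange finite_nbrs)
        ultimately show ?thesis using deg[OF vG(1) v] fin by (metis card_mono order_trans)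
      next
        case False
        then have "nbrs G v \<subseteq> nbrs ?H v"
          using nbrs_contract_edge[of _ G v w e x] e vG by auto
        then show ?thesis using deg[OF vG(1) v] fin by (meson card_mono order_trans)
      qed
    qed (use e z \<open>z \<noteq> w\<close> \<open>z \<in> verts G\<close> wG less.prems(2) vH multigraph_contract_edge
        in \<open>auto simp: contract_edge_simps(2)\<close>)
  next
    case (triangles w0)
    have card3: "card (nbrs G w) = 3" if "w \<in> nbrs G x" for w
      using triangles(2)[OF that] deg[of w] nbr_verts[OF that] nbrs_irrefl[of x G] that by force
    have third: "\<exists>a. nbrs G w = {x, z, a} \<and> a \<notin> {x, z, w}" if "w \<in> nbrs G x" "z \<in> nbrs G x" "z \<in> nbrs G w" for w z
    proof -
      have "x \<in> nbrs G w" "z \<noteq> x" using that nbrs_sym[of x G w] nbrs_irrefl[of x G] by auto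
      then have "card (nbrs G w - {x, z}) = 1" using card3[OF that(1)] that(3) by (simp add: card_Diff_subset)
      then obtain a where "nbrs G w - {x, z} = {a}" by (auto simp: card_1_singleton_iff)
      then have "nbrs G w = {x, z, a} \<and> a \<notin> {x, z}" using \<open>x \<in> nbrs G w\<close> that(3) by blast
      moreover from this have "a \<noteq> w" using nbrs_irrefl[of w G] by blast
      ultimately show ?thesis by blast
    qed
    show ?thesis
    proof (cases "\<exists>w z a b. w \<in> nbrs G x \<and> z \<in> nbrs G x \<and> nbrs G w = {x, z, a} \<and> nbrs G z = {x, w, b} \<and>
        a \<notin> {x, z, w} \<and> b \<notin> {x, w, z} \<and> a \<noteq> b")
      case True
      then obtain w z a b where wz: "w \<in> nbrs G x" "z \<in> nbrs G x" "nbrs G w = {x, z, a}" "nbrs G z = {x, w, b}"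
        "a \<notin> {x, z, w}" "b \<notin> {x, w, z}" "a \<noteq> b" by metis
      have "z \<in> nbrs G w" using wz by simp
      then obtain e where e: "z \<noteq> w" "e \<in> edges G" "ends G e = {w, z}" by (auto elim: nbrsE)
      \<comment> \<open>The merged vertex keeps the three neighbours \<open>x\<close>,
        \<open>a\<close>, \<open>b\<close>. Since \<open>a \<noteq> b\<close>, the only vertex that
        loses a neighbour without replacement is \<open>x\<close>, which is exceptional.\<close>
      let ?H = "contract_edge G e w z"
      have mH: "multigraph ?H" by (rule multigraph_contract_edge)
      have vH: "verts ?H = verts G - {z}" using e nbr_verts[OF wz(1)] by (intro verts_contract_edge) auto
      have ne: "w \<noteq> x" "z \<noteq> x" using wz(1,2) nbrs_irrefl by metis+
      show ?thesis
      proof (rule step[of ?H x w])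
        show "reduces_to G ?H" using e by (intro reduces_to.contract_edge reduces_to.refl)
        fix v assume "v \<in> verts ?H" and v: "v \<noteq> x"
        then have vG: "v \<in> verts G" "v \<noteq> z" by (auto simp: vH)
        show "card (nbrs ?H v) \<ge> 3"
        proof (cases "v = w")
          case True
          have "{x, a, b} \<subseteq> nbrs ?H w"
            using nbrs_contract_edge[of _ G w z e w] nbrs_contract_edge_merged[of _ G z w e] e wz ne by auto
          from card_nbrs_ge3I[OF mH this] show ?thesis using True wz(5-7) by auto
        next
          case False
          show ?thesis
          proof (cases "z \<in> nbrs G v")
            case True
            then have "v \<in> nbrs G z" by (simp add: nbrs_sym)
            then have "v = b" using wz v False by auto
            then have "w \<notin> nbrs G v" using wz nbrs_sym[of w G v] by auto
            have "insert w (nbrs G v - {z}) \<subseteq> nbrs ?H v"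
              using nbrs_contract_edge[of _ G v z e w] nbrs_contract_edge_merged[of v G z w e]
                \<open>v \<in> nbrs G z\<close> e v vG False nbrs_sym[of v ?H w] by auto
            moreover have "card (insert w (nbrs G v - {z})) = card (nbrs G v)"
              using True \<open>w \<notin> nbrs G v\<close> by (intro card_exchange finite_nbrs)
            ultimately show ?thesis
              using deg[OF vG(1) v] multigraph.finite_nbrs[OF mH] by (metis card_mono order_trans)
          next
            case False
            then have "nbrs G v \<subseteq> nbrs ?H v"
              using nbrs_contract_edge[of _ G v z e w] e vG by auto
            then show ?thesis
              using deg[OF vG(1) v] multigraph.finite_nbrs[OF mH] by (meson card_mono order_trans)
          qed
        qed
      qed (use e ne nbr_verts[OF wz(1)] nbr_verts[OF wz(2)] less.prems(2) vH mH
          in \<open>auto simp: contract_edge_simps(2)\<close>)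
    next
      case False
      \<comment> \<open>From here on, adjacent neighbours \<open>w\<close>, \<open>z\<close> of
        \<open>x\<close> have the same third neighbour \<open>a\<close>, so \<open>x\<close>,
        \<open>w\<close>, \<open>z\<close>, \<open>a\<close> span a diamond or, if \<open>a\<close>
        is adjacent to \<open>x\<close>, a \<open>K4\<close>.\<close>
      have same: "nbrs G z = {x, w, a}"
        if "w \<in> nbrs G x" "z \<in> nbrs G x" "nbrs G w = {x, z, a}" "a \<notin> {x, z, w}" for w z a
      proof -
        have "w \<in> nbrs G z" using that(3) nbrs_sym[of w G z] by simp
        from third[OF that(2,1) this] obtain b where b: "nbrs G z = {x, w, b}" "b \<notin> {x, w, z}"
          by blast
        with False that have "a = b" by blast
        with b show ?thesis by simp
      qed
      obtain z where z: "z \<in> nbrs G x" "z \<in> nbrs G w0" using triangles(1,3) by blast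
      define w where "w = w0"
      have w: "w \<in> nbrs G x" using triangles(1) by (simp add: w_def)
      obtain a where a: "nbrs G w = {x, z, a}" "a \<notin> {x, z, w}"
        using third[OF w z(1)] z(2) by (auto simp: w_def)
      have nz: "nbrs G z = {x, w, a}" by (rule same[OF w z(1) a])
      have ne: "w \<noteq> x" "z \<noteq> x" "w \<noteq> z" using w z(1) a nbrs_irrefl[of _ G] by (metis, metis, metis insertCI)
      have aG: "a \<in> verts G" using nbr_verts[of a w] a by simp
      have wa: "{w, z} \<subseteq> nbrs G a" using a nz nbrs_sym[of w G a] nbrs_sym[of z G a] by simp
      show ?thesis
      proof (cases "a \<in> nbrs G x")
        case True
        have "x \<in> nbrs G a" using True by (simp add: nbrs_sym)
        then have "v \<in> nbrs G u" if "u \<in> {x, w, z, a}" "v \<in> {x, w, z, a}" "u \<noteq> v" for u v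
          using that w z(1) a(1) nz True wa by fastforce
        then show ?thesis
          using a ne nbr_verts[OF w] nbr_verts[OF z(1)] less.prems(2) aG
          by (intro has_complete_minor_if_clique[of "{x, w, z, a}"]) auto
      next
        case xa: False
        obtain e where e: "e \<in> edges G" "ends G e = {x, w}" using w by (auto elim: nbrsE)
        \<comment> \<open>The diamond shrinks to an edge between \<open>x\<close> and
          \<open>a\<close>: \<open>w\<close> is merged into \<open>x\<close> and \<open>z\<close>
          deleted. Outside the diamond no vertex is adjacent to \<open>w\<close> or
          \<open>z\<close>, so only \<open>a\<close> needs care; it trades two neighbours for
          one.\<close>
        define H1 where "H1 = contract_edge G e x w"
        define H where "H = delete_vertex H1 z"
        have mH1: "multigraph H1" unfolding H1_def by (rule multigraph_contract_edge)
        then interpret H1: multigraph H1 .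
        have mH: "multigraph H" unfolding H_def by (rule H1.multigraph_delete_vertex)
        then interpret H: multigraph H .
        have vH1: "verts H1 = verts G - {w}"
          unfolding H1_def using ne less.prems(2) by (intro verts_contract_edge) auto
        then have vH: "verts H = verts G - {w, z}" by (auto simp: H_def delete_vertex_def)
        have eH: "edges H \<subseteq> edges G" by (auto simp: H_def delete_vertex_def H1_def contract_edge_simps)
        have "reduces_to G H1" unfolding H1_def using e by (intro reduces_to.contract_edge reduces_to.refl)
        then have redH: "reduces_to G H"
          unfolding H_def using vH1 nbr_verts[OF z(1)] ne by (intro reduces_to.delete_vertex) auto
        have keep: "y \<in> nbrs H v" if "y \<in> nbrs G v" "y \<notin> {w, z}" "v \<notin> {w, z}" for v y
          unfolding H_def H1_def using that e by (intro nbrs_delete_vertex nbrs_contract_edge) auto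
        have "a \<in> nbrs H x"
          unfolding H_def H1_def
          using a e ne by (intro nbrs_delete_vertex nbrs_contract_edge_merged) auto
        then have xaH: "x \<in> nbrs H a" by (simp add: nbrs_sym)
        have other: "nbrs G v \<subseteq> nbrs H v" if "v \<notin> {x, w, z, a}" for v
        proof
          fix y assume y: "y \<in> nbrs G v"
          then have "v \<in> nbrs G y" by (simp add: nbrs_sym)
          then have "y \<notin> {w, z}" using that a nz by auto
          then show "y \<in> nbrs H v" using keep y that by blast
        qed
        show ?thesis
        proof (cases "card (nbrs G a) \<ge> 4")
          case True
          show ?thesis
          proof (rule step[OF redH mH _ eH, of x a])
            fix v assume "v \<in> verts H" and v: "v \<noteq> x"
            then have vG: "v \<in> verts G" "v \<notin> {w, z}" by (auto simp: vH)
            show "card (nbrs H v) \<ge> 3"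
            proof (cases "v = a")
              case True
              have "insert x (nbrs G a - {w, z}) \<subseteq> nbrs H a" using keep[of _ a] xaH a by auto
              then have "card (insert x (nbrs G a - {w, z})) \<le> card (nbrs H a)"
                by (rule card_mono[OF H.finite_nbrs])
              moreover have "x \<notin> nbrs G a" using xa by (simp add: nbrs_sym)
              then have "card (insert x (nbrs G a - {w, z})) = Suc (card (nbrs G a) - 2)"
                using wa ne finite_nbrs[of a] by (simp add: card_Diff_subset)
              ultimately have "3 \<le> card (nbrs H a)" using \<open>4 \<le> card (nbrs G a)\<close> by linarith
              then show ?thesis using True by simp
            next
              case False
              then have "nbrs G v \<subseteq> nbrs H v" using v vG by (intro other) simp
              then have "card (nbrs G v) \<le> card (nbrs H v)" by (rule card_mono[OF H.finite_nbrs])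
              then show ?thesis using deg[OF vG(1) v] by linarith
            qed
          qed (use a ne less.prems(2) vH aG nbr_verts[OF w] in auto)
        next
          case False
          then have "card (nbrs G a) = 3" using deg[OF aG] a by force
          then have "card (nbrs G a - {w, z}) = 1" using wa ne by (simp add: card_Diff_subset)
          then obtain c where "nbrs G a - {w, z} = {c}" by (auto simp: card_1_singleton_iff)
          then have c: "nbrs G a = {w, z, c}" "c \<notin> {w, z}" using wa by blast+
          have cx: "c \<noteq> x" using xa c nbrs_sym[of a G x] by auto
          have ca: "c \<noteq> a" using c nbrs_irrefl[of a G] by auto
          have ac: "a \<in> nbrs G c" using c nbrs_sym[of c G a] by simp
          \<comment> \<open>Otherwise \<open>c\<close> would lie in a triangle with \<open>x\<close>
            and some \<open>c'\<close>. By \<open>same\<close>, \<open>a\<close> would be the common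
            third neighbour, making \<open>c'\<close> equal to \<open>w\<close> or \<open>z\<close>;
            but these are not adjacent to \<open>c\<close>.\<close>
          have "c \<notin> nbrs G x"
          proof
            assume cN: "c \<in> nbrs G x"
            then obtain c' where c': "c' \<in> nbrs G c" "c' \<in> nbrs G x" using triangles(3) by blast
            then obtain b where b: "nbrs G c = {x, c', b}" "b \<notin> {x, c', c}" using third[OF cN c'(2) c'(1)] by blast
            have "a \<noteq> c'" using c'(2) xa by auto
            then have "b = a" using ac b(1) a(2) by auto
            then have "nbrs G c' = {x, c, a}" using same[OF cN c'(2) b] by simp
            then have "c' \<in> nbrs G a" "c \<in> nbrs G c'" using nbrs_sym[of a G c'] by auto
            moreover have "c' \<noteq> c" using c'(1) nbrs_irrefl by metis
            ultimately have "c \<in> nbrs G w \<or> c \<in> nbrs G z" using c(1) by auto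
            then show False using a nz c ca cx by auto
          qed
          then have xc: "x \<notin> nbrs G c" by (simp add: nbrs_sym)
          have cG: "c \<in> verts G" using nbr_verts[of c a] c by simp
          obtain f where f: "f \<in> edges H" "ends H f = {x, a}"
            using \<open>a \<in> nbrs H x\<close> by (auto elim: nbrsE)
          \<comment> \<open>With degree 3, \<open>a\<close> would be left with only \<open>x\<close>
            and \<open>c\<close>, so it is merged into \<open>x\<close> as well. Then
            \<open>c\<close> exchanges \<open>a\<close> for \<open>x\<close>, which was not among
            its neighbours.\<close>
          define K where "K = contract_edge H f x a"
          have mK: "multigraph K" unfolding K_def by (rule H.multigraph_contract_edge)
          have vK: "verts K = verts G - {w, z, a}"
            unfolding K_def using verts_contract_edge[of x H a f] vH ne a less.prems(2) by auto
          have redK: "reduces_to G K"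
            unfolding K_def using redH f by (rule reduces_to.contract_edge)
          show ?thesis
          proof (rule step[OF redK mK, of x c])
            show "edges K \<subseteq> edges G" using eH by (auto simp: K_def contract_edge_simps)
            fix v assume "v \<in> verts K" and v: "v \<noteq> x"
            then have vG: "v \<in> verts G" "v \<notin> {w, z, a}" by (auto simp: vK)
            have keepK: "y \<in> nbrs K v" if "y \<in> nbrs G v" "y \<noteq> a" for y
              unfolding K_def using that other[of v] v vG f by (intro nbrs_contract_edge) auto
            show "card (nbrs K v) \<ge> 3"
            proof (cases "v = c")
              case True
              have "c \<in> nbrs H a" using other[of c] ac c cx ca nbrs_sym[of a H c] by auto
              then have "c \<in> nbrs K x"
                unfolding K_def using cx f by (intro nbrs_contract_edge_merged) auto
              then have "x \<in> nbrs K c" by (simp add: nbrs_sym)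
              then have "insert x (nbrs G c - {a}) \<subseteq> nbrs K c" using keepK True by auto
              moreover have "card (insert x (nbrs G c - {a})) = card (nbrs G c)"
                using ac xc by (intro card_exchange finite_nbrs)
              ultimately show ?thesis
                using True deg[OF vG(1) v] multigraph.finite_nbrs[OF mK] by (metis card_mono order_trans)
            next
              case False
              then have "a \<notin> nbrs G v" using c(1) vG nbrs_sym[of a G v] by auto
              then have "nbrs G v \<subseteq> nbrs K v" using keepK by auto
              then show ?thesis
                using deg[OF vG(1) v] multigraph.finite_nbrs[OF mK] by (meson card_mono order_trans)
            qed
          qed (use cx ca c cG less.prems(2) vK ne a nbr_verts[OF w] in auto)
        qed
      qed
    qed
  qed
qed

section \<open>Series-parallel graphs\<close>

lemma series_parallel_reduces_to: "reduces_to G H \<Longrightarrow> series_parallel G \<Longrightarrow> series_parallel H"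
  unfolding series_parallel_def using has_minor_reduces_to by blast

text \<open>Any vertex can play the exceptional one. It is returned as \<open>w\<close>, because
  connectivity to a second vertex shows that \<open>v\<close> is not isolated.\<close>

lemma (in multigraph) exists_degree_le_2:
  assumes "series_parallel G" "card (verts G) \<noteq> 1" "verts G \<noteq> {}"
  obtains v w where "v \<in> verts G" "w \<in> verts G" "v \<noteq> w" "card (nbrs G v) \<le> 2"
proof -
  obtain x where x: "x \<in> verts G" using assms(3) by blast
  moreover have "verts G \<noteq> {x}" using assms(2) by auto
  ultimately have "\<exists>v\<in>verts G. v \<noteq> x \<and> \<not> card (nbrs G v) \<ge> 3"
    using has_K4_minor_if_degrees_ge_3[OF multigraph_axioms, of x] assms(1)
    by (auto simp: series_parallel_def)
  then obtain v where "v \<in> verts G" "v \<noteq> x" "\<not> card (nbrs G v) \<ge> 3" by blast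
  with x show ?thesis by (intro that[of v x]) auto
qed

lemma (in multigraph) edges_at_simple:
  assumes noloop: "\<And>e v. e \<in> edges G \<Longrightarrow> ends G e \<noteq> {v}"
    and nopar: "\<And>e f. e \<in> edges G \<Longrightarrow> f \<in> edges G \<Longrightarrow> ends G e = ends G f \<Longrightarrow> e = f"
    and g: "\<And>u. u \<in> nbrs G v \<Longrightarrow> g u \<in> edges G \<and> ends G (g u) = {u, v}"
  shows "{f \<in> edges G. v \<in> ends G f} = g ` nbrs G v"
proof
  show "{f \<in> edges G. v \<in> ends G f} \<subseteq> g ` nbrs G v"
  proof
    fix f assume f: "f \<in> {f \<in> edges G. v \<in> ends G f}"
    then obtain x y where "ends G f = {x, y}" using edge_endsE by blast
    with f obtain u where u: "ends G f = {v, u}" by (auto simp: insert_commute)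
    then have "u \<noteq> v" using noloop[of f v] f by auto
    then have "u \<in> nbrs G v" using f u by (auto intro: nbrsI)
    moreover from this have "f = g u" using g[of u] nopar[of f "g u"] f u by (auto simp: insert_commute)
    ultimately show "f \<in> g ` nbrs G v" by blast
  qed
  show "g ` nbrs G v \<subseteq> {f \<in> edges G. v \<in> ends G f}" using g by auto
qed

text \<open>Induction on the number of edges, undoing one construction step each time. Loops and
  doubled edges are deleted, edges at a vertex of degree 1 or 2 contracted; all these minors stay
  connected and series-parallel.\<close>

lemma poly_sparse_min_conn:
  assumes "multigraph G" "connected_mgraph G" "series_parallel G"
  shows "poly_sparse (edges G) (min_conn G)"
  using assms
proof (induction "card (edges G)" arbitrary: G rule: less_induct)
  case less
  interpret multigraph G by (rule less.prems(1))
  have con: "conn G (edges G)" using less.prems(2) by (simp add: conn_edges)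
  have step: "poly_sparse (edges H) (min_conn H)" "min_conn H \<noteq> {}" "finite (edges H)" "e \<notin> edges H"
    "edges G = insert e (edges H)"
    if "e \<in> edges G" "edges H = edges G - {e}" "reduces_to G H" "multigraph H" "conn H (edges H)" for e H
  proof -
    have con_H: "connected_mgraph H" using that(5) by (simp add: conn_edges)
    have "edges H \<subset> edges G" using that(1,2) by blast
    then have "card (edges H) < card (edges G)" by (rule psubset_card_mono[OF finite_edges])
    then show "poly_sparse (edges H) (min_conn H)"
      using that(4) con_H series_parallel_reduces_to[OF that(3) less.prems(3)] by (rule less.hyps)
    show "min_conn H \<noteq> {}" by (rule multigraph.min_conn_nonempty[OF that(4) con_H])
    show "finite (edges H)" using that(2) finite_edges by simp
    show "e \<notin> edges H" "edges G = insert e (edges H)" using that(1,2) by blast+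
  qed
  have step_delete: "poly_sparse (edges H) (min_conn H)" "min_conn H \<noteq> {}" "finite (edges H)" "e \<notin> edges H"
    "edges G = insert e (edges H)"
    if "e \<in> edges G" "conn G (edges G - {e})" "H = delete_edge G e" for e H
  proof -
    have H: "edges H = edges G - {e}" "reduces_to G H" "multigraph H" "conn H (edges H)"
      using that multigraph_delete_edge reduces_to.delete_edge[OF reduces_to.refl that(1)]
      by (simp_all add: conn_delete_edge) (simp_all add: delete_edge_def)
    show "poly_sparse (edges H) (min_conn H)" "min_conn H \<noteq> {}" "finite (edges H)" "e \<notin> edges H"
      "edges G = insert e (edges H)"
      using step[OF that(1) H] by blast+
  qed
  have step_contract: "poly_sparse (edges H) (min_conn H)" "min_conn H \<noteq> {}" "finite (edges H)" "e \<notin> edges H"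
    "edges G = insert e (edges H)"
    if "e \<in> edges G" "ends G e = {u, v}" "H = contract_edge G e u v" for e u v H
  proof -
    have H: "edges H = edges G - {e}" "reduces_to G H" "multigraph H" "conn H (edges H)"
      using that multigraph_contract_edge reduces_to.contract_edge[OF reduces_to.refl that(1,2)]
        con conn_contract[OF subset_refl that(1,2)]
      by (simp_all add: contract_edge_simps(2))
    show "poly_sparse (edges H) (min_conn H)" "min_conn H \<noteq> {}" "finite (edges H)" "e \<notin> edges H"
      "edges G = insert e (edges H)"
      using step[OF that(1) H] by blast+
  qed
  consider (loop) e v where "e \<in> edges G" "ends G e = {v}"
    | (parallel) e f where "e \<in> edges G" "f \<in> edges G" "e \<noteq> f" "ends G e = ends G f"
    | (simple) "\<And>e v. e \<in> edges G \<Longrightarrow> ends G e \<noteq> {v}"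
        "\<And>e f. e \<in> edges G \<Longrightarrow> f \<in> edges G \<Longrightarrow> ends G e = ends G f \<Longrightarrow> e = f"
    by blast
  then show ?case
  proof cases
    case loop
    define H where "H = delete_edge G e"
    have "conn G (edges G - {e})" using con loop(2) by (intro conn_remove[of _ _ _ v v]) auto
    note H = step_delete[OF loop(1) this H_def]
    have "poly_sparse (edges G) (min_conn H)"
      unfolding H(5) by (rule poly_sparse_insert[OF H(1,3) min_conn_subset H(4)])
    then show ?thesis
      by (rule poly_sparse_mono) (use min_conn_loop[OF loop(2)] in \<open>simp add: H_def\<close>)
  next
    case parallel
    obtain u v where uv: "ends G e = {u, v}" using edge_endsE[OF parallel(1)] by blast
    then have uvf: "ends G f = {u, v}" using parallel by simp
    define H where "H = delete_edge G f"
    have "(u, v) \<in> adj_by G (edges G - {f})" using parallel uv by (auto simp: adj_rel_def)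
    then have "conn G (edges G - {f})" using con uvf by (intro conn_remove[of _ _ _ u v]) auto
    note H = step_delete[OF parallel(2) this H_def]
    have "e \<in> edges H" using H(5) parallel by blast
    have "poly_sparse (edges G) (par_ext e f (min_conn H))"
      unfolding H(5) by (rule poly_sparse_par_ext[OF H(1,3) min_conn_subset H(2) \<open>e \<in> edges H\<close> H(4)])
    then show ?thesis
      by (rule poly_sparse_mono) (use min_conn_parallel[OF parallel(3,1) uv uvf] in \<open>simp add: H_def\<close>)
  next
    case simple
    show ?thesis
    proof (cases "card (verts G) = 1")
      case True
      then obtain x where x: "verts G = {x}" by (auto simp: card_1_singleton_iff)
      have E: "edges G = {}"
      proof (rule ccontr)
        assume "edges G \<noteq> {}"
        then obtain e where e: "e \<in> edges G" by blast
        then obtain u v where "ends G e = {u, v}" "u \<in> verts G" "v \<in> verts G" by (rule edge_endsE)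
        with x simple(1)[OF e] show False by auto
      qed
      then have "min_conn G \<subseteq> {{}}" using min_conn_subset[of G] by auto
      then show ?thesis unfolding E by (rule poly_sparse_mono[OF poly_sparse_empty])
    next
      case False
      have "verts G \<noteq> {}" using con by (simp add: conn_iff)
      from less.prems(3) False this obtain v w where v: "v \<in> verts G" "w \<in> verts G" "v \<noteq> w" "card (nbrs G v) \<le> 2"
        by (rule exists_degree_le_2)
      define g where "g u = (SOME e. e \<in> edges G \<and> ends G e = {u, v})" for u
      have g: "g u \<in> edges G \<and> ends G (g u) = {u, v}" if "u \<in> nbrs G v" for u
      proof -
        have "\<exists>e. e \<in> edges G \<and> ends G e = {u, v}" using that by (auto elim!: nbrsE)
        then show ?thesis unfolding g_def by (rule someI_ex)
      qed
      have at_v: "{f \<in> edges G. v \<in> ends G f} = g ` nbrs G v"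
        using simple g by (rule edges_at_simple)
      obtain f where "f \<in> edges G" "v \<in> ends G f"
        using conn_incident[OF con v(2,1)] v(3) by metis
      then have "nbrs G v \<noteq> {}" using at_v by blast
      \<comment> \<open>Degree 0 is ruled out by connectivity; degree 1 gives a pendant edge and
        degree 2 a subdivided one.\<close>
      then have "card (nbrs G v) \<noteq> 0" using finite_nbrs by simp
      with v(4) consider "card (nbrs G v) = 1" | "card (nbrs G v) = 2" by linarith
      then show ?thesis
      proof cases
        case 1
        then obtain u where u: "nbrs G v = {u}" by (auto simp: card_1_singleton_iff)
        then have uv: "u \<noteq> v" using nbrs_irrefl[of v G] by auto
        have e: "g u \<in> edges G" "ends G (g u) = {u, v}" using g u by auto
        define H where "H = contract_edge G (g u) u v"
        note H = step_contract[OF e H_def]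
        have "poly_sparse (edges G) (insert (g u) ` min_conn H)"
          unfolding H(5) by (rule poly_sparse_coloop[OF H(1,3) min_conn_subset H(4)])
        moreover have "min_conn G \<subseteq> insert (g u) ` min_conn H"
          unfolding H_def using at_v u e uv by (intro min_conn_pendant) auto
        ultimately show ?thesis by (rule poly_sparse_mono)
      next
        case 2
        then obtain a b where ab: "nbrs G v = {a, b}" "a \<noteq> b" by (auto simp: card_2_iff)
        then have ne: "a \<noteq> v" "b \<noteq> v" using nbrs_irrefl[of v G] by auto
        have ea: "g a \<in> edges G" "ends G (g a) = {a, v}" and eb: "g b \<in> edges G" "ends G (g b) = {b, v}"
          using g ab by auto
        have gab: "g a \<noteq> g b" using ea eb ab(2) by (metis doubleton_eq_iff)
        define H where "H = contract_edge G (g b) b v"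
        note H = step_contract[OF eb H_def]
        have "g a \<in> edges H" using H(5) ea(1) gab by blast
        have "poly_sparse (edges G) (ser_ext (g a) (g b) (min_conn H))"
          unfolding H(5) by (rule poly_sparse_ser_ext[OF H(1,3) min_conn_subset H(2) \<open>g a \<in> edges H\<close> H(4)])
        moreover have "min_conn G \<subseteq> ser_ext (g a) (g b) (min_conn H)"
          unfolding H_def using at_v ab ea eb ne gab by (intro min_conn_series[of v _ _ a]) auto
        ultimately show ?thesis by (rule poly_sparse_mono)
      qed
    qed
  qed
qed

section \<open>Embeddings of cubes\<close>

text \<open>The counterpart of \<open>cube_map\<close> on strings: bit \<open>l\<close> moves to
  position \<open>p l\<close>, and inequality of truth values is the exclusive or with the offset
  \<open>B\<close>.\<close>

definition face_map :: "nat \<Rightarrow> nat \<Rightarrow> (nat \<Rightarrow> nat) \<Rightarrow> nat set \<Rightarrow> bool list \<Rightarrow> bool list" where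
  "face_map d n p B x = map (\<lambda>k. (\<exists>l<d. p l = k \<and> x ! l) \<noteq> (k \<in> B)) [0..<n]"

text \<open>The free coordinates of the face are the range of \<open>p\<close>, and \<open>B\<close>
  fixes the others. Differing positions correspond under the injection \<open>p\<close>, so
  adjacency is preserved both ways.\<close>

lemma cube_embedding_face_map:
  assumes p: "inj_on p {..<d}" "p ` {..<d} \<subseteq> {..<n}"
  shows "cube_embedding d n (face_map d n p B)"
proof -
  let ?\<psi> = "face_map d n p B"
  define a where "a = map (\<lambda>k. k \<in> B) [0..<n]"
  define F where "F = {y \<in> cube n. \<forall>k\<in>{..<n} - p ` {..<d}. y ! k = a ! k}"
  have pn: "p l < n" if "l < d" for l using p(2) that by auto
  have len: "length (?\<psi> x) = n" for x by (simp add: face_map_def)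
  have at_p: "?\<psi> x ! p l \<longleftrightarrow> x ! l \<noteq> (p l \<in> B)" if "l < d" for x l
  proof -
    have "(\<exists>l'<d. p l' = p l \<and> x ! l') \<longleftrightarrow> x ! l"
      using p(1) that by (auto simp: inj_on_def)
    then show ?thesis using pn[OF that] by (simp add: face_map_def)
  qed
  have off_p: "?\<psi> x ! k \<longleftrightarrow> k \<in> B" if "k < n" "k \<notin> p ` {..<d}" for x k
    using that by (auto simp: face_map_def)
  have "is_face d n F"
    unfolding is_face_def
    by (intro exI[of _ "p ` {..<d}"] exI[of _ a] conjI)
      (use p in \<open>auto simp: card_image F_def a_def cube_def\<close>)
  moreover have "bij_betw ?\<psi> (cube d) F"
    unfolding bij_betw_def
  proof
    show "inj_on ?\<psi> (cube d)"
    proof (rule inj_onI)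
      fix x y assume xy: "x \<in> cube d" "y \<in> cube d" "?\<psi> x = ?\<psi> y"
      then have "x ! l = y ! l" if "l < d" for l
        using at_p[OF that, of x] at_p[OF that, of y] by auto
      then show "x = y" using xy by (auto simp: cube_def intro: nth_equalityI)
    qed
    show "?\<psi> ` cube d = F"
    proof
      show "?\<psi> ` cube d \<subseteq> F" using off_p len by (auto simp: F_def cube_def a_def)
      show "F \<subseteq> ?\<psi> ` cube d"
      proof
        fix y assume y: "y \<in> F"
        define x where "x = map (\<lambda>l. y ! p l \<noteq> (p l \<in> B)) [0..<d]"
        have "?\<psi> x ! k = y ! k" if "k < n" for k
        proof (cases "k \<in> p ` {..<d}")
          case True
          then obtain l where "l < d" "k = p l" by auto
          then show ?thesis using at_p[of l x] by (auto simp: x_def)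
        next
          case False
          then show ?thesis using off_p[of k x] that y by (auto simp: F_def a_def)
        qed
        then have "?\<psi> x = y" using y len by (auto simp: F_def cube_def intro: nth_equalityI)
        moreover have "x \<in> cube d" by (simp add: x_def cube_def)
        ultimately show "y \<in> ?\<psi> ` cube d" by blast
      qed
    qed
  qed
  moreover have "cube_adj x y \<longleftrightarrow> cube_adj (?\<psi> x) (?\<psi> y)" if "x \<in> cube d" "y \<in> cube d" for x y
  proof -
    have "{k. k < n \<and> ?\<psi> x ! k \<noteq> ?\<psi> y ! k} = p ` {l. l < d \<and> x ! l \<noteq> y ! l}" (is "?L = ?R")
    proof
      show "?L \<subseteq> ?R"
      proof
        fix k assume k: "k \<in> ?L"
        then obtain l where l: "l < d" "k = p l" using off_p[of k x] off_p[of k y] by auto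
        then have "x ! l \<noteq> y ! l" using k at_p[of l x] at_p[of l y] by auto
        with l show "k \<in> ?R" by blast
      qed
      show "?R \<subseteq> ?L" using at_p pn by auto
    qed
    moreover have "card (p ` {l. l < d \<and> x ! l \<noteq> y ! l}) = card {l. l < d \<and> x ! l \<noteq> y ! l}"
      using p(1) by (intro card_image) (auto simp: inj_on_def)
    ultimately show ?thesis using that len by (simp add: cube_adj_def cube_def)
  qed
  ultimately show ?thesis unfolding cube_embedding_def by blast
qed

section \<open>Strings as sets of coordinates\<close>

definition ones :: "bool list \<Rightarrow> nat set" where
  "ones x = {k. k < length x \<and> x ! k}"

lemma inj_on_ones: "inj_on ones (cube n)"
proof (rule inj_onI)
  fix x y assume xy: "x \<in> cube n" "y \<in> cube n" "ones x = ones y"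
  then have "x ! k = y ! k" if "k < n" for k
    using that by (auto simp: ones_def cube_def set_eq_iff)
  then show "x = y" using xy by (auto simp: cube_def intro: nth_equalityI)
qed

text \<open>A pair \<open>(f, B)\<close> gives the embedding \<open>face_map\<close> with
  \<open>p l = f (es ! l)\<close>, so a set that avoids all embeddings of \<open>X\<close> also has
  no copy in the sense of \<open>copies\<close>.\<close>

lemma copies_ones_empty:
  assumes es: "distinct es" and X: "X \<subseteq> Pow (set es)" and S: "S \<subseteq> cube n"
    and free: "\<And>\<psi>. cube_embedding (length es) n \<psi> \<Longrightarrow> \<not> \<psi> ` (\<lambda>T. map (\<lambda>e. e \<in> T) es) ` X \<subseteq> S"
  shows "copies (set es) X {..<n} (ones ` S) = {}"
proof (rule ccontr)
  assume "copies (set es) X {..<n} (ones ` S) \<noteq> {}"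
  then obtain f B where f: "f \<in> set es \<rightarrow>\<^sub>E {..<n}" "f ` set es \<subseteq> {..<n}" "inj_on f (set es)" "B \<subseteq> {..<n}"
    "\<forall>T\<in>X. cube_map f B T \<in> ones ` S"
    by (rule copies_nonemptyE)
  define d where "d = length es"
  define p where "p = (\<lambda>l. f (es ! l))"
  have "inj_on p {..<d}"
  proof (rule inj_onI)
    fix l l' assume l: "l \<in> {..<d}" "l' \<in> {..<d}" "p l = p l'"
    then have "es ! l = es ! l'"
      using inj_onD[OF f(3), of "es ! l" "es ! l'"] by (simp add: p_def d_def)
    then show "l = l'" using es l by (simp add: d_def nth_eq_iff_index_eq)
  qed
  moreover have "p ` {..<d} \<subseteq> {..<n}" using f(2) nth_mem[of _ es] by (fastforce simp: p_def d_def)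
  ultimately have emb: "cube_embedding (length es) n (face_map d n p B)"
    unfolding d_def by (rule cube_embedding_face_map)
  have "face_map d n p B (map (\<lambda>e. e \<in> T) es) \<in> S" if T: "T \<in> X" for T
  proof -
    let ?y = "face_map d n p B (map (\<lambda>e. e \<in> T) es)"
    from f(5) T obtain y where y: "y \<in> S" "cube_map f B T = ones y" by auto
    have "(\<exists>l<d. p l = k \<and> map (\<lambda>e. e \<in> T) es ! l) \<longleftrightarrow> k \<in> f ` T" for k
    proof -
      have "k \<in> f ` T \<longleftrightarrow> (\<exists>l<d. p l = k \<and> es ! l \<in> T)"
      proof
        assume "k \<in> f ` T"
        then obtain e where e: "e \<in> T" "k = f e" by blast
        then have "e \<in> set es" using X T by blast
        then obtain l where "l < d" "e = es ! l" by (auto simp: in_set_conv_nth d_def)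
        with e show "\<exists>l<d. p l = k \<and> es ! l \<in> T" by (auto simp: p_def)
      qed (auto simp: p_def)
      then show ?thesis by (auto simp: d_def)
    qed
    then have "?y = map (\<lambda>k. (k \<in> f ` T) \<noteq> (k \<in> B)) [0..<n]" by (simp add: face_map_def)
    moreover have "cube_map f B T \<subseteq> {..<n}"
      unfolding cube_map_def using f(2,4) X T by blast
    ultimately have "ones ?y = cube_map f B T"
      by (auto simp: ones_def cube_map_def)
    then have "ones ?y = ones y" using y by simp
    moreover have "?y \<in> cube n" by (simp add: face_map_def cube_def)
    ultimately have "?y = y" using inj_on_ones y(1) S by (meson inj_on_def subsetD)
    then show ?thesis using y(1) by simp
  qed
  then show False using free[OF emb] by blast
qed

text \<open>For nonempty \<open>X\<close> the empty set is admissible, so the maximum ranges over a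
  nonempty finite set and is attained.\<close>

lemma cube_ex_attained:
  assumes "X \<noteq> {}"
  obtains S where "S \<subseteq> cube n" "\<forall>\<psi>. cube_embedding d n \<psi> \<longrightarrow> \<not> \<psi> ` X \<subseteq> S" "cube_ex d n X = card S"
proof -
  let ?A = "{card S | S. S \<subseteq> cube n \<and> (\<forall>\<psi>. cube_embedding d n \<psi> \<longrightarrow> \<not> \<psi> ` X \<subseteq> S)}"
  have "finite (cube n)" using finite_lists_length_eq[of "UNIV :: bool set" n] by (simp add: cube_def)
  then have "finite ?A"
    by (intro finite_subset[of ?A "card ` Pow (cube n)"]) auto
  moreover have "card {} \<in> ?A" by (intro CollectI exI[of _ "{}"]) (use assms in auto)
  ultimately have "cube_ex d n X \<in> ?A"
    unfolding cube_ex_def by (intro Max_in) blast+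
  then obtain S where "cube_ex d n X = card S" "S \<subseteq> cube n"
    "\<forall>\<psi>. cube_embedding d n \<psi> \<longrightarrow> \<not> \<psi> ` X \<subseteq> S" by blast
  then show ?thesis by (intro that[of S]) simp_all
qed

theorem theorem1p1:
  fixes G :: "('v, 'e) mgraph" and es :: "'e list"
  assumes "multigraph G"
    and "connected_mgraph G"
    and "series_parallel G"
    and "distinct es" and "set es = edges G"
  shows "\<exists>\<epsilon>::real. \<epsilon> > 0 \<and>
    (\<lambda>n::nat. real (cube_ex (length es) n (tree_strings G es)))
      \<in> O(\<lambda>n. real n powr (- \<epsilon>) * 2 ^ n)"
proof -
  interpret multigraph G by fact
  let ?X = "tree_strings G es"
  have X: "?X = (\<lambda>T. map (\<lambda>e. e \<in> T) es) ` min_conn G"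
    by (auto simp: tree_strings_def spanning_tree_iff)
  have X_ne: "?X \<noteq> {}" using min_conn_nonempty[OF assms(2)] by (simp add: X)
  have sub: "min_conn G \<subseteq> Pow (set es)" using min_conn_subset assms(5) by metis
  obtain \<epsilon> C where \<epsilon>: "\<epsilon> > 0" and
    C: "\<And>(V::nat set) S. finite V \<Longrightarrow> V \<noteq> {} \<Longrightarrow> S \<subseteq> Pow V \<Longrightarrow> copies (edges G) (min_conn G) V S = {} \<Longrightarrow>
        real (card S) \<le> C * real (card V) powr (- \<epsilon>) * 2 ^ card V"
    using poly_sparse_min_conn[OF assms(1-3)] unfolding poly_sparse_def by metis
  \<comment> \<open>For \<open>n = 0\<close> the ground set would be empty, where
    \<open>poly_sparse\<close> says nothing; the asymptotic bound ignores this value.\<close>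
  have "real (cube_ex (length es) n ?X) \<le> C * (real n powr (- \<epsilon>) * 2 ^ n)" if n: "n \<ge> 1" for n
  proof -
    from X_ne obtain S where S: "S \<subseteq> cube n" "\<forall>\<psi>. cube_embedding (length es) n \<psi> \<longrightarrow> \<not> \<psi> ` ?X \<subseteq> S"
      and ex: "cube_ex (length es) n ?X = card S"
      by (rule cube_ex_attained)
    have "copies (edges G) (min_conn G) {..<n} (ones ` S) = {}"
      using copies_ones_empty[OF assms(4) sub S(1)] S(2) assms(5) by (simp add: X)
    moreover have "ones ` S \<subseteq> Pow {..<n}" using S(1) by (auto simp: ones_def cube_def)
    moreover have "{..<n} \<noteq> {}" using n by (auto simp: lessThan_empty_iff)
    ultimately have "real (card (ones ` S)) \<le> C * real (card {..<n}) powr (- \<epsilon>) * 2 ^ card {..<n}"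
      by (intro C) auto
    moreover have "card (ones ` S) = card S"
      using inj_on_subset[OF inj_on_ones S(1)] by (rule card_image)
    ultimately show ?thesis by (simp add: ex mult.assoc)
  qed
  then have "(\<lambda>n. real (cube_ex (length es) n ?X)) \<in> O(\<lambda>n. real n powr (- \<epsilon>) * 2 ^ n)"
    by (intro bigoI[of _ C] eventually_sequentiallyI[of 1]) simp
  with \<epsilon> show ?thesis by blast
qed

end
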